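(* Let $U$ be a discrete group with torsion, let $e\in\mathbb{C}[U]$ be a nontrivial projection ($e=e^*=e^2$, $e\neq 0,1$), and let $W$ be the inverse of the coefficient of $1$ in the expression of $e$ as a $\mathbb{C}$-linear combination of elements of $U$. Let $T=et+t^{-1}e\in\mathbb{C}[U\wr\mathbb{Z}]$. Then for every $\mu\in\mathbb{R}$, \[ \dim_{U\wr\mathbb{Z}}\ker(T-\mu)=\begin{cases}\dfrac{(W-1)^2}{W^n-1} & \text{if } n\ge 2 \text{ and } \mu\in M_n,\\[2mm] 0 & \text{if } \mu\notin\bigcup_{n\ge 2}M_n.\end{cases} \] Moreover, $l^2(U\wr\mathbb{Z})$ is the Hilbert sum of the eigenspaces of (left multiplication by) $T$, i.e. the spectral measure of $T$ off its eigenspaces is zero.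
   Context: $U\wr\mathbb{Z}=(\bigoplus_{i\in\mathbb{Z}}U)\rtimes C_\infty$, where $C_\infty$ is infinite cyclic with generator $t$ acting by the shift $t^{-1}((g_n)_{n})t=(g_{n-1})_n$; $U$ is identified with the subgroup of elements $(\dots,1,u,1,\dots)$ with $u$ in position $0$. Elements of $\mathbb{C}[U\wr\mathbb{Z}]$ are identified with elements of $l^2(U\wr\mathbb{Z})$ and with operators of left multiplication in the group von Neumann algebra $\mathcal{N}(U\wr\mathbb{Z})$ (bounded operators on $l^2(U\wr\mathbb{Z})$ commuting with right multiplication by group elements). The trace is $\mathrm{tr}_{U\wr\mathbb{Z}}(a)=\langle a(1),1\rangle$. For $\mu\in\mathbb{R}$, $\dim_{U\wr\mathbb{Z}}\ker(T-\mu):=\mathrm{tr}_{U\wr\mathbb{Z}}(\mathrm{pr}_\mu)$, where $\mathrm{pr}_\mu$ is the orthogonal projection of $l^2(U\wr\mathbb{Z})$ onto $\ker(T-\mu)$. For integers $1\le m\le n-1$, $\lambda_{m,n}=2\cos(\frac{m}{n}\pi)$, and for $n\ge 2$, $M_n=\{\lambda_{m,n}\mid 1\le m\le n-1,\ m \text{ coprime to } n\}$. *)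

theory Defs
  imports "HOL-Analysis.Analysis" "HOL-Algebra.Group"
begin

text \<open>An element (g,k) represents g t^k, where g : int => U is finitely supported.
  Since t^k h t^(-k) has n-th component h(n+k), the product is
  (g,k)(h,l) = (n |-> g n * h (n+k), k+l). Then t^(-1) x t has n-th component x(n-1).\<close>

definition wreath_Z :: "('a,'b) monoid_scheme \<Rightarrow> ((int \<Rightarrow> 'a) \<times> int) monoid" where
  "wreath_Z U = \<lparr>carrier = {(f,k). (\<forall>n. f n \<in> carrier U) \<and> finite {n. f n \<noteq> \<one>\<^bsub>U\<^esub>}},
                 mult = (\<lambda>(f,k) (g,l). (\<lambda>n. f n \<otimes>\<^bsub>U\<^esub> g (n + k), k + l)),
                 one = (\<lambda>n. \<one>\<^bsub>U\<^esub>, 0)\<rparr>"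

definition wr_embed :: "('a,'b) monoid_scheme \<Rightarrow> 'a \<Rightarrow> (int \<Rightarrow> 'a) \<times> int" where
  "wr_embed U u = (\<lambda>n. if n = 0 then u else \<one>\<^bsub>U\<^esub>, 0)"

definition wr_t :: "('a,'b) monoid_scheme \<Rightarrow> (int \<Rightarrow> 'a) \<times> int" where
  "wr_t U = (\<lambda>n. \<one>\<^bsub>U\<^esub>, 1)"

definition wr_tinv :: "('a,'b) monoid_scheme \<Rightarrow> (int \<Rightarrow> 'a) \<times> int" where
  "wr_tinv U = (\<lambda>n. \<one>\<^bsub>U\<^esub>, -1)"

definition grp_alg :: "('g,'b) monoid_scheme \<Rightarrow> ('g \<Rightarrow> complex) set" where
  "grp_alg G = {a. finite {x. a x \<noteq> 0} \<and> {x. a x \<noteq> 0} \<subseteq> carrier G}"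

definition delta :: "'g \<Rightarrow> 'g \<Rightarrow> complex" where
  "delta g = (\<lambda>x. if x = g then 1 else 0)"

text \<open>Product a*b in C[G] (a finitely supported); for b in l^2(G) this is the
  operator of left multiplication by a applied to b.\<close>
definition conv :: "('g,'b) monoid_scheme \<Rightarrow> ('g \<Rightarrow> complex) \<Rightarrow> ('g \<Rightarrow> complex) \<Rightarrow> 'g \<Rightarrow> complex" where
  "conv G a b = (\<lambda>x. if x \<in> carrier G
      then (\<Sum>g\<in>{g. a g \<noteq> 0}. a g * b (inv\<^bsub>G\<^esub> g \<otimes>\<^bsub>G\<^esub> x)) else 0)"

definition star :: "('g,'b) monoid_scheme \<Rightarrow> ('g \<Rightarrow> complex) \<Rightarrow> 'g \<Rightarrow> complex" where
  "star G a = (\<lambda>x. if x \<in> carrier G then cnj (a (inv\<^bsub>G\<^esub> x)) else 0)"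

definition wr_lift :: "('a,'b) monoid_scheme \<Rightarrow> ('a \<Rightarrow> complex) \<Rightarrow> ((int \<Rightarrow> 'a) \<times> int) \<Rightarrow> complex" where
  "wr_lift U e = (\<lambda>x. \<Sum>u\<in>{u. e u \<noteq> 0}. e u * delta (wr_embed U u) x)"

definition l2 :: "'g set \<Rightarrow> ('g \<Rightarrow> complex) set" where
  "l2 X = {\<xi>. (\<forall>x. x \<notin> X \<longrightarrow> \<xi> x = 0) \<and> (\<lambda>x. (cmod (\<xi> x))\<^sup>2) summable_on X}"

definition l2_inner :: "'g set \<Rightarrow> ('g \<Rightarrow> complex) \<Rightarrow> ('g \<Rightarrow> complex) \<Rightarrow> complex" where
  "l2_inner X \<xi> \<eta> = infsum (\<lambda>x. \<xi> x * cnj (\<eta> x)) X"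

definition l2_norm :: "'g set \<Rightarrow> ('g \<Rightarrow> complex) \<Rightarrow> real" where
  "l2_norm X \<xi> = sqrt (infsum (\<lambda>x. (cmod (\<xi> x))\<^sup>2) X)"

definition eigsp :: "('g,'b) monoid_scheme \<Rightarrow> ('g \<Rightarrow> complex) \<Rightarrow> real \<Rightarrow> ('g \<Rightarrow> complex) set" where
  "eigsp G T \<mu> = {\<xi> \<in> l2 (carrier G). conv G T \<xi> = (\<lambda>x. complex_of_real \<mu> * \<xi> x)}"

definition orth_proj :: "'g set \<Rightarrow> ('g \<Rightarrow> complex) set \<Rightarrow> ('g \<Rightarrow> complex) \<Rightarrow> 'g \<Rightarrow> complex" where
  "orth_proj X K \<xi> = (THE k. k \<in> K \<and> (\<forall>\<eta>\<in>K. l2_inner X (\<lambda>x. \<xi> x - k x) \<eta> = 0))"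

text \<open>dim_G ker(T - mu) = tr_G(pr_mu) = < pr_mu(1), 1 >.\<close>
definition vN_dim_ker :: "('g,'b) monoid_scheme \<Rightarrow> ('g \<Rightarrow> complex) \<Rightarrow> real \<Rightarrow> complex" where
  "vN_dim_ker G T \<mu> = l2_inner (carrier G)
      (orth_proj (carrier G) (eigsp G T \<mu>) (delta \<one>\<^bsub>G\<^esub>)) (delta \<one>\<^bsub>G\<^esub>)"

definition M_set :: "nat \<Rightarrow> real set" where
  "M_set n = {2 * cos (real m / real n * pi) | m. 1 \<le> m \<and> m \<le> n - 1 \<and> coprime m n}"

end

theory Submission
  imports Defs
begin

text \<open>Write \<open>e\<^sub>i = t\<^sup>-\<^sup>i e t\<^sup>i\<close> for the copy of \<open>e\<close> at site \<open>i\<close>. These projections commute, \<open>t e\<^sub>i = e\<^sub>i\<^sub>-\<^sub>1 t\<close>, and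
  \<open>T = t e\<^sub>1 + t\<^sup>-\<^sup>1 e\<^sub>0\<close>. For \<open>1 \<le> j < n\<close> let \<open>p\<^sub>n\<^sub>,\<^sub>j\<close> be the product of \<open>1 - e\<close> at the sites \<open>1 - j\<close> and
  \<open>n - j\<close> with \<open>e\<close> at all sites strictly between. Then
  \<open>T p\<^sub>n\<^sub>,\<^sub>j = p\<^sub>n\<^sub>,\<^sub>j\<^sub>+\<^sub>1 t + p\<^sub>n\<^sub>,\<^sub>j\<^sub>-\<^sub>1 t\<^sup>-\<^sup>1\<close> with \<open>p\<^sub>n\<^sub>,\<^sub>0 = p\<^sub>n\<^sub>,\<^sub>n = 0\<close>, so \<open>T\<close> acts as the adjacency matrix of
  a path with \<open>n - 1\<close> vertices. It is diagonalised by the discrete sine transform, with simple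
  eigenvalues \<open>2 cos (m \<pi> / n)\<close>, each contributing \<open>w\<^sup>n\<^sup>-\<^sup>2 (1 - w)\<^sup>2\<close> to the trace, where \<open>w = 1 / W\<close> is the
  trace of \<open>e\<close>. Since the traces of the orthogonal \<open>p\<^sub>n\<^sub>,\<^sub>j\<close> add up to
  \<open>\<Sum>\<^sub>n (n - 1) w\<^sup>n\<^sup>-\<^sup>2 (1 - w)\<^sup>2 = 1\<close>, these eigenvectors exhaust \<open>l\<^sup>2\<close>, and \<open>2 cos (p \<pi> / q)\<close> in lowest terms
  has multiplicity \<open>\<Sum>\<^sub>i w\<^sup>i\<^sup>q\<^sup>-\<^sup>2 (1 - w)\<^sup>2 = (W - 1)\<^sup>2 / (W\<^sup>q - 1)\<close>.\<close>

section \<open>Square-summable functions\<close>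

lemma l2_finite_sum_le:
  assumes "\<xi> \<in> l2 X" "finite F" "F \<subseteq> X"
  shows "L2_set (\<lambda>x. cmod (\<xi> x)) F \<le> l2_norm X \<xi>"
  unfolding L2_set_def l2_norm_def using assms
  by (intro real_sqrt_le_mono finite_sum_le_infsum) (auto simp: l2_def)

lemma l2_norm_nonneg [simp]: "l2_norm X \<xi> \<ge> 0"
  unfolding l2_norm_def by (simp add: infsum_nonneg)

lemma l2_norm_power2: "(l2_norm X \<xi>)\<^sup>2 = infsum (\<lambda>x. (cmod (\<xi> x))\<^sup>2) X"
  unfolding l2_norm_def by (simp add: infsum_nonneg)

text \<open>Testing on finite sets turns membership and norm bounds into inequalities for
  \<open>L2_set\<close>, so the finite Minkowski inequality extends to infinite index sets.\<close>

lemma l2I_bound: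
  assumes "\<And>x. x \<notin> X \<Longrightarrow> \<xi> x = 0"
    and bd: "\<And>F. finite F \<Longrightarrow> F \<subseteq> X \<Longrightarrow> L2_set (\<lambda>x. cmod (\<xi> x)) F \<le> C"
  shows "\<xi> \<in> l2 X" "l2_norm X \<xi> \<le> C"
proof -
  have C: "C \<ge> 0" using bd[of "{}"] by simp
  have b: "(\<Sum>x\<in>F. (cmod (\<xi> x))\<^sup>2) \<le> C\<^sup>2" if "finite F" "F \<subseteq> X" for F
    using bd[OF that] unfolding L2_set_def by (meson sqrt_le_D)
  have s: "(\<lambda>x. (cmod (\<xi> x))\<^sup>2) summable_on X"
    using b by (intro nonneg_bdd_above_summable_on bdd_aboveI[where M="C\<^sup>2"]) auto
  then show "\<xi> \<in> l2 X" using assms(1) by (auto simp: l2_def)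
  have "infsum (\<lambda>x. (cmod (\<xi> x))\<^sup>2) X \<le> C\<^sup>2"
    using s b by (intro infsum_le_finite_sums) auto
  then show "l2_norm X \<xi> \<le> C" unfolding l2_norm_def using C by (simp add: real_le_lsqrt infsum_nonneg)
qed

lemma l2_outside: "\<xi> \<in> l2 X \<Longrightarrow> x \<notin> X \<Longrightarrow> \<xi> x = 0"
  by (auto simp: l2_def)

lemma l2_zero [simp]: "(\<lambda>x. 0) \<in> l2 X"
  by (auto simp: l2_def)

lemma l2_finite_support:
  assumes "finite {x. \<xi> x \<noteq> 0}" "{x. \<xi> x \<noteq> 0} \<subseteq> X"
  shows "\<xi> \<in> l2 X"
proof -
  have "(\<lambda>x. (cmod (\<xi> x))\<^sup>2) summable_on {x. \<xi> x \<noteq> 0}" using assms by simp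
  then have "(\<lambda>x. (cmod (\<xi> x))\<^sup>2) summable_on X"
    by (rule summable_on_cong_neutral[THEN iffD1, rotated -1]) (use assms in auto)
  then show ?thesis using assms by (auto simp: l2_def)
qed

lemma
  assumes "\<xi> \<in> l2 X" "\<eta> \<in> l2 X"
  shows l2_add: "(\<lambda>x. \<xi> x + \<eta> x) \<in> l2 X"
    and l2_norm_triangle: "l2_norm X (\<lambda>x. \<xi> x + \<eta> x) \<le> l2_norm X \<xi> + l2_norm X \<eta>"
proof -
  have o: "\<And>x. x \<notin> X \<Longrightarrow> \<xi> x + \<eta> x = 0" by (simp add: l2_outside[OF assms(1)] l2_outside[OF assms(2)])
  have b: "L2_set (\<lambda>x. cmod (\<xi> x + \<eta> x)) F \<le> l2_norm X \<xi> + l2_norm X \<eta>"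
    if "finite F" "F \<subseteq> X" for F
  proof -
    have "L2_set (\<lambda>x. cmod (\<xi> x + \<eta> x)) F \<le> L2_set (\<lambda>x. cmod (\<xi> x) + cmod (\<eta> x)) F"
      by (intro L2_set_mono norm_triangle_ineq) auto
    also have "\<dots> \<le> L2_set (\<lambda>x. cmod (\<xi> x)) F + L2_set (\<lambda>x. cmod (\<eta> x)) F"
      by (rule L2_set_triangle_ineq)
    finally show ?thesis using l2_finite_sum_le[OF assms(1) that] l2_finite_sum_le[OF assms(2) that] by simp
  qed
  show "(\<lambda>x. \<xi> x + \<eta> x) \<in> l2 X" by (rule l2I_bound[OF o b])
  show "l2_norm X (\<lambda>x. \<xi> x + \<eta> x) \<le> l2_norm X \<xi> + l2_norm X \<eta>" by (rule l2I_bound[OF o b])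
qed

lemma l2_scale:
  assumes "\<xi> \<in> l2 X" shows "(\<lambda>x. c * \<xi> x) \<in> l2 X"
  using assms by (auto simp: l2_def norm_mult power_mult_distrib intro!: summable_on_cmult_right)

lemma l2_norm_scale: "l2_norm X (\<lambda>x. c * \<xi> x) = cmod c * l2_norm X \<xi>"
  unfolding l2_norm_def by (simp add: norm_mult power_mult_distrib infsum_cmult_right' real_sqrt_mult)

lemma l2_diff:
  assumes "\<xi> \<in> l2 X" "\<eta> \<in> l2 X" shows "(\<lambda>x. \<xi> x - \<eta> x) \<in> l2 X"
  using l2_add[OF assms(1) l2_scale[OF assms(2), of "-1"]] by simp

lemma l2_norm_triangle_diff:
  assumes "\<xi> \<in> l2 X" "\<eta> \<in> l2 X"
  shows "l2_norm X (\<lambda>x. \<xi> x - \<eta> x) \<le> l2_norm X \<xi> + l2_norm X \<eta>"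
  using l2_norm_triangle[OF assms(1) l2_scale[OF assms(2), of "-1"]] l2_norm_scale[of X "-1" \<eta>] by simp

lemma l2_norm_zero [simp]: "l2_norm X (\<lambda>x. 0) = 0"
  by (simp add: l2_norm_def)

lemma l2_sum:
  assumes "\<And>i. i \<in> A \<Longrightarrow> \<xi> i \<in> l2 X"
  shows "(\<lambda>x. \<Sum>i\<in>A. \<xi> i x) \<in> l2 X"
  using assms by (induction A rule: infinite_finite_induct) (auto intro: l2_add)

lemma l2_norm_sum_le:
  assumes "\<And>i. i \<in> A \<Longrightarrow> \<xi> i \<in> l2 X"
  shows "l2_norm X (\<lambda>x. \<Sum>i\<in>A. \<xi> i x) \<le> (\<Sum>i\<in>A. l2_norm X (\<xi> i))"
  using assms
proof (induction A rule: infinite_finite_induct)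
  case (insert a A)
  then show ?case
    using l2_norm_triangle[of "\<xi> a" X "\<lambda>x. \<Sum>i\<in>A. \<xi> i x"] l2_sum[of A \<xi> X] by force
qed auto

lemma cmod_le_l2_norm:
  assumes "\<xi> \<in> l2 X" shows "cmod (\<xi> x) \<le> l2_norm X \<xi>"
proof (cases "x \<in> X")
  case True
  then show ?thesis using l2_finite_sum_le[OF assms, of "{x}"] by simp
qed (simp add: l2_outside[OF assms])

section \<open>Inner product\<close>

lemma
  assumes "\<xi> \<in> l2 X" "\<eta> \<in> l2 X"
  shows l2_inner_abs_summable: "(\<lambda>x. norm (\<xi> x * cnj (\<eta> x))) summable_on X"
    and l2_Cauchy_Schwarz: "cmod (l2_inner X \<xi> \<eta>) \<le> l2_norm X \<xi> * l2_norm X \<eta>"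
proof -
  \<comment> \<open>The finite Cauchy-Schwarz inequality gives a bound independent of
    \<open>F\<close>, which yields both summability and the estimate.\<close>
  have b: "(\<Sum>x\<in>F. norm (\<xi> x * cnj (\<eta> x))) \<le> l2_norm X \<xi> * l2_norm X \<eta>"
    if "finite F" "F \<subseteq> X" for F
  proof -
    have "(\<Sum>x\<in>F. norm (\<xi> x * cnj (\<eta> x))) = (\<Sum>x\<in>F. \<bar>cmod (\<xi> x)\<bar> * \<bar>cmod (\<eta> x)\<bar>)"
      by (simp add: norm_mult)
    also have "\<dots> \<le> L2_set (\<lambda>x. cmod (\<xi> x)) F * L2_set (\<lambda>x. cmod (\<eta> x)) F"
      by (rule L2_set_mult_ineq)
    also have "\<dots> \<le> l2_norm X \<xi> * l2_norm X \<eta>"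
      by (intro mult_mono l2_finite_sum_le assms that) (auto simp: L2_set_nonneg)
    finally show ?thesis .
  qed
  show s: "(\<lambda>x. norm (\<xi> x * cnj (\<eta> x))) summable_on X"
    using b by (intro nonneg_bdd_above_summable_on bdd_aboveI[where M="l2_norm X \<xi> * l2_norm X \<eta>"]) auto
  have "cmod (l2_inner X \<xi> \<eta>) \<le> infsum (\<lambda>x. norm (\<xi> x * cnj (\<eta> x))) X"
    unfolding l2_inner_def by (rule norm_infsum_bound[OF s])
  also have "\<dots> \<le> l2_norm X \<xi> * l2_norm X \<eta>"
    using s b by (intro infsum_le_finite_sums) auto
  finally show "cmod (l2_inner X \<xi> \<eta>) \<le> l2_norm X \<xi> * l2_norm X \<eta>" .
qed

lemma l2_inner_summable:
  assumes "\<xi> \<in> l2 X" "\<eta> \<in> l2 X"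
  shows "(\<lambda>x. \<xi> x * cnj (\<eta> x)) summable_on X"
  by (rule abs_summable_summable[OF l2_inner_abs_summable[OF assms]])

lemma l2_inner_cnj: "l2_inner X \<eta> \<xi> = cnj (l2_inner X \<xi> \<eta>)"
  unfolding l2_inner_def by (simp flip: infsum_cnj add: mult.commute)

lemma l2_inner_add_left:
  assumes "\<xi> \<in> l2 X" "\<zeta> \<in> l2 X" "\<eta> \<in> l2 X"
  shows "l2_inner X (\<lambda>x. \<xi> x + \<zeta> x) \<eta> = l2_inner X \<xi> \<eta> + l2_inner X \<zeta> \<eta>"
  unfolding l2_inner_def
  by (simp add: distrib_right infsum_add l2_inner_summable assms)

lemma l2_inner_scale_left: "l2_inner X (\<lambda>x. c * \<xi> x) \<eta> = c * l2_inner X \<xi> \<eta>"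
  unfolding l2_inner_def by (simp add: mult.assoc infsum_cmult_right')

lemma l2_inner_scale_right: "l2_inner X \<xi> (\<lambda>x. c * \<eta> x) = cnj c * l2_inner X \<xi> \<eta>"
  by (subst (1 2) l2_inner_cnj) (simp add: l2_inner_scale_left)

lemma l2_inner_diff_left:
  assumes "\<xi> \<in> l2 X" "\<zeta> \<in> l2 X" "\<eta> \<in> l2 X"
  shows "l2_inner X (\<lambda>x. \<xi> x - \<zeta> x) \<eta> = l2_inner X \<xi> \<eta> - l2_inner X \<zeta> \<eta>"
  using l2_inner_add_left[OF assms(1) l2_scale[OF assms(2), of "-1"] assms(3)]
    l2_inner_scale_left[of X "-1" \<zeta> \<eta>] by simp

lemma l2_inner_zero_left [simp]: "l2_inner X (\<lambda>x. 0) \<eta> = 0"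
  by (simp add: l2_inner_def)

lemma l2_inner_sum_left:
  assumes "\<And>i. i \<in> A \<Longrightarrow> \<xi> i \<in> l2 X" "\<eta> \<in> l2 X"
  shows "l2_inner X (\<lambda>x. \<Sum>i\<in>A. \<xi> i x) \<eta> = (\<Sum>i\<in>A. l2_inner X (\<xi> i) \<eta>)"
  using assms
proof (induction A rule: infinite_finite_induct)
  case (insert a A)
  then show ?case by (simp add: l2_inner_add_left l2_sum)
qed auto

lemma l2_inner_sum_right:
  assumes "\<And>i. i \<in> A \<Longrightarrow> \<xi> i \<in> l2 X" "\<eta> \<in> l2 X"
  shows "l2_inner X \<eta> (\<lambda>x. \<Sum>i\<in>A. \<xi> i x) = (\<Sum>i\<in>A. l2_inner X \<eta> (\<xi> i))"
  by (subst (1 2) l2_inner_cnj) (simp add: l2_inner_sum_left assms)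

lemma l2_inner_diff_right:
  assumes "\<xi> \<in> l2 X" "\<zeta> \<in> l2 X" "\<eta> \<in> l2 X"
  shows "l2_inner X \<eta> (\<lambda>x. \<xi> x - \<zeta> x) = l2_inner X \<eta> \<xi> - l2_inner X \<eta> \<zeta>"
  by (subst (1 2 3) l2_inner_cnj) (simp add: l2_inner_diff_left assms)

lemma l2_inner_self:
  assumes "\<xi> \<in> l2 X" shows "l2_inner X \<xi> \<xi> = of_real ((l2_norm X \<xi>)\<^sup>2)"
proof -
  have "l2_inner X \<xi> \<xi> = infsum (\<lambda>x. of_real ((cmod (\<xi> x))\<^sup>2)) X"
    unfolding l2_inner_def by (intro infsum_cong) (rule complex_norm_square[symmetric])
  also have "\<dots> = of_real (infsum (\<lambda>x. (cmod (\<xi> x))\<^sup>2) X)"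
    using assms by (intro infsumI has_sum_of_real has_sum_infsum) (auto simp: l2_def)
  finally show ?thesis by (simp add: l2_norm_power2)
qed

lemma l2_inner_self_eq_0:
  assumes "\<xi> \<in> l2 X" "l2_inner X \<xi> \<xi> = 0" shows "\<xi> = (\<lambda>x. 0)"
proof
  fix x
  have "l2_norm X \<xi> = 0" using assms by (simp add: l2_inner_self)
  then show "\<xi> x = 0" using cmod_le_l2_norm[OF assms(1), of x] by simp
qed

lemma l2_inner_delta:
  assumes "g \<in> X" shows "l2_inner X \<xi> (delta g) = \<xi> g"
proof -
  have "l2_inner X \<xi> (delta g) = infsum (\<lambda>x. \<xi> x * cnj (delta g x)) {g}"
    unfolding l2_inner_def using assms by (intro infsum_cong_neutral) (auto simp: delta_def)
  then show ?thesis by (simp add: delta_def)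
qed

lemma l2_delta: "g \<in> X \<Longrightarrow> delta g \<in> l2 X"
  by (rule l2_finite_support) (auto simp: delta_def)

text \<open>The Weierstrass test in norm: point evaluations are bounded by the norm, so the limit
  can be defined pointwise, and the tails of \<open>c\<close> control the error.\<close>

lemma l2_suminf:
  fixes \<xi> :: "nat \<Rightarrow> 'g \<Rightarrow> complex"
  assumes l2: "\<And>n. \<xi> n \<in> l2 X" and bd: "\<And>n. l2_norm X (\<xi> n) \<le> c n" and sm: "summable c"
  defines "k \<equiv> \<lambda>x. \<Sum>n. \<xi> n x"
  shows l2_suminf_sums: "(\<lambda>n. \<xi> n x) sums k x"
    and l2_suminf_in_l2: "k \<in> l2 X"
    and l2_suminf_tendsto: "(\<lambda>B. l2_norm X (\<lambda>x. k x - (\<Sum>n<B. \<xi> n x))) \<longlonglongrightarrow> 0"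
proof -
  have c0: "c n \<ge> 0" for n using bd[of n] l2_norm_nonneg order_trans by blast
  have sums: "(\<lambda>n. \<xi> n x) sums k x" for x
  proof -
    have "summable (\<lambda>n. \<xi> n x)"
      by (rule summable_comparison_test'[OF sm, of 0])
        (meson bd cmod_le_l2_norm l2 order_trans)
    then show ?thesis unfolding k_def by (rule summable_sums)
  qed
  then show "(\<lambda>n. \<xi> n x) sums k x" .
  have ss: "(\<lambda>x. \<Sum>n<B. \<xi> n x) \<in> l2 X" for B using l2 by (intro l2_sum)
  \<comment> \<open>On a finite set pointwise convergence suffices: the bound for the partial sums
    up to \<open>C\<close> survives the limit in \<open>C\<close>.\<close>
  have fin: "L2_set (\<lambda>x. cmod (k x - (\<Sum>n<B. \<xi> n x))) F \<le> (\<Sum>n. c (n + B))"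
    if F: "finite F" "F \<subseteq> X" for B F
  proof (rule LIMSEQ_le_const2)
    show "(\<lambda>C. L2_set (\<lambda>x. cmod ((\<Sum>n<C. \<xi> n x) - (\<Sum>n<B. \<xi> n x))) F)
      \<longlonglongrightarrow> L2_set (\<lambda>x. cmod (k x - (\<Sum>n<B. \<xi> n x))) F"
      unfolding L2_set_def using sums[unfolded sums_def]
      by (intro tendsto_intros) auto
    show "\<exists>N. \<forall>C\<ge>N. L2_set (\<lambda>x. cmod ((\<Sum>n<C. \<xi> n x) - (\<Sum>n<B. \<xi> n x))) F \<le> (\<Sum>n. c (n + B))"
    proof (intro exI allI impI)
      fix C assume C: "C \<ge> B"
      have eq: "(\<Sum>n<C. \<xi> n x) - (\<Sum>n<B. \<xi> n x) = (\<Sum>n\<in>{B..<C}. \<xi> n x)" for x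
        using C by (simp add: lessThan_atLeast0 sum_diff_nat_ivl)
      have "L2_set (\<lambda>x. cmod (\<Sum>n\<in>{B..<C}. \<xi> n x)) F \<le> l2_norm X (\<lambda>x. \<Sum>n\<in>{B..<C}. \<xi> n x)"
        by (rule l2_finite_sum_le[OF l2_sum[OF l2] F])
      also have "\<dots> \<le> (\<Sum>n\<in>{B..<C}. c n)"
        by (rule order_trans[OF l2_norm_sum_le[OF l2] sum_mono[OF bd]])
      also have "\<dots> = (\<Sum>n<C-B. c (n + B))"
        using C sum.shift_bounds_nat_ivl[of c 0 B "C - B"] by (simp add: lessThan_atLeast0)
      also have "\<dots> \<le> (\<Sum>n. c (n + B))"
        by (rule sum_le_suminf) (use sm c0 summable_iff_shift in auto)
      finally show "L2_set (\<lambda>x. cmod ((\<Sum>n<C. \<xi> n x) - (\<Sum>n<B. \<xi> n x))) F \<le> (\<Sum>n. c (n + B))"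
        by (simp add: eq)
    qed
  qed
  have out: "k x - (\<Sum>n<B. \<xi> n x) = 0" if "x \<notin> X" for x B
    using l2_outside[OF l2 that] by (simp add: k_def)
  note tail = l2I_bound[OF out fin]
  \<comment> \<open>The empty partial sum gives membership of \<open>k\<close> itself.\<close>
  have "(\<lambda>x. k x - (\<Sum>n<0. \<xi> n x)) \<in> l2 X" by (rule tail(1))
  then show "k \<in> l2 X" by simp
  show "(\<lambda>B. l2_norm X (\<lambda>x. k x - (\<Sum>n<B. \<xi> n x))) \<longlonglongrightarrow> 0"
  proof (rule tendsto_sandwich[OF _ _ tendsto_const])
    show "(\<lambda>B. \<Sum>n. c (n + B)) \<longlonglongrightarrow> 0" by (rule suminf_exist_split2[OF sm])
    show "\<forall>\<^sub>F B in sequentially. l2_norm X (\<lambda>x. k x - (\<Sum>n<B. \<xi> n x)) \<le> (\<Sum>n. c (n + B))"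
      using tail(2) by simp
  qed simp
qed

lemma l2_finite_approx:
  assumes "\<xi> \<in> l2 X" "\<epsilon> > 0"
  obtains F where "finite F" "F \<subseteq> X"
    "l2_norm X (\<lambda>x. \<xi> x - (\<Sum>g\<in>F. \<xi> g * delta g x)) < \<epsilon>"
proof -
  have s: "(\<lambda>x. (cmod (\<xi> x))\<^sup>2) summable_on X" using assms by (auto simp: l2_def)
  \<comment> \<open>Halving turns the weak bound of the approximation into the strict one that is
    claimed.\<close>
  obtain F where F: "finite F" "F \<subseteq> X"
    "dist (\<Sum>x\<in>F. (cmod (\<xi> x))\<^sup>2) (infsum (\<lambda>x. (cmod (\<xi> x))\<^sup>2) X) \<le> \<epsilon>\<^sup>2 / 2"
    using infsum_finite_approximation[OF s, of "\<epsilon>\<^sup>2 / 2"] assms by auto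
  have eq: "(\<Sum>g\<in>F. \<xi> g * delta g x) = (if x \<in> F then \<xi> x else 0)" for x
    using F(1) by (simp add: delta_def if_distrib cong: if_cong)
  have "infsum (\<lambda>x. (cmod (\<xi> x - (\<Sum>g\<in>F. \<xi> g * delta g x)))\<^sup>2) X
      = infsum (\<lambda>x. (cmod (\<xi> x))\<^sup>2) (X - F)"
    unfolding eq by (intro infsum_cong_neutral) auto
  also have "\<dots> = infsum (\<lambda>x. (cmod (\<xi> x))\<^sup>2) X - (\<Sum>x\<in>F. (cmod (\<xi> x))\<^sup>2)"
    using F s by (subst infsum_Diff) auto
  also have "\<dots> < \<epsilon>\<^sup>2" using F(3) assms(2) by (auto simp: dist_real_def abs_le_iff)
      (smt (verit) zero_less_power)
  finally have "l2_norm X (\<lambda>x. \<xi> x - (\<Sum>g\<in>F. \<xi> g * delta g x)) < \<epsilon>"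
    unfolding l2_norm_def using assms(2) by (intro real_less_lsqrt) (auto simp: infsum_nonneg)
  with F that show ?thesis by blast
qed

lemma l2_inner_reindex:
  assumes "bij_betw h X X"
  shows "l2_inner X (\<lambda>x. \<xi> (h x)) (\<lambda>x. \<eta> (h x)) = l2_inner X \<xi> \<eta>"
  unfolding l2_inner_def by (rule infsum_reindex_bij_betw[OF assms, of "\<lambda>x. \<xi> x * cnj (\<eta> x)"])

lemma l2_cong_inner:
  assumes "\<And>x. x \<in> X \<Longrightarrow> \<xi> x = \<xi>' x" "\<And>x. x \<in> X \<Longrightarrow> \<eta> x = \<eta>' x"
  shows "l2_inner X \<xi> \<eta> = l2_inner X \<xi>' \<eta>'"
  unfolding l2_inner_def by (intro infsum_cong) (simp add: assms)

text \<open>The composite is cut off outside \<open>X\<close> because \<open>l2\<close> demands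
  vanishing there while \<open>h\<close> is only controlled on \<open>X\<close>.\<close>

lemma l2_bij_compose:
  assumes "bij_betw h X X" "\<xi> \<in> l2 X"
  shows "(\<lambda>x. if x \<in> X then \<xi> (h x) else 0) \<in> l2 X"
    and "l2_norm X (\<lambda>x. if x \<in> X then \<xi> (h x) else 0) = l2_norm X \<xi>"
proof -
  have "(\<lambda>x. (cmod (\<xi> (h x)))\<^sup>2) summable_on X"
    using assms summable_on_reindex_bij_betw[OF assms(1), of "\<lambda>x. (cmod (\<xi> x))\<^sup>2"] by (simp add: l2_def)
  then have "(\<lambda>x. (cmod (if x \<in> X then \<xi> (h x) else 0))\<^sup>2) summable_on X"
    by (rule summable_on_cong[THEN iffD1, rotated]) auto
  then show "(\<lambda>x. if x \<in> X then \<xi> (h x) else 0) \<in> l2 X" by (simp add: l2_def)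
  have "infsum (\<lambda>x. (cmod (if x \<in> X then \<xi> (h x) else 0))\<^sup>2) X = infsum (\<lambda>x. (cmod (\<xi> (h x)))\<^sup>2) X"
    by (rule infsum_cong) auto
  then show "l2_norm X (\<lambda>x. if x \<in> X then \<xi> (h x) else 0) = l2_norm X \<xi>"
    unfolding l2_norm_def using infsum_reindex_bij_betw[OF assms(1), of "\<lambda>x. (cmod (\<xi> x))\<^sup>2"] by simp
qed

section \<open>Left multiplication by elements of the group algebra\<close>

context group
begin

text \<open>Zero coefficients may be added, so convolutions by different elements can be summed over
  one common finite set.\<close>

lemma conv_eq_sum:
  assumes "finite S" "{g. a g \<noteq> 0} \<subseteq> S" "x \<in> carrier G"
  shows "conv G a \<xi> x = (\<Sum>g\<in>S. a g * \<xi> (inv g \<otimes> x))"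
  using assms unfolding conv_def by (auto intro!: sum.mono_neutral_left)

lemma conv_outside: "x \<notin> carrier G \<Longrightarrow> conv G a \<xi> x = 0"
  by (simp add: conv_def)

lemma conv_zero_right [simp]: "conv G a (\<lambda>x. 0) = (\<lambda>x. 0)"
  by (auto simp: conv_def)

lemma conv_add_right: "conv G a (\<lambda>x. \<xi> x + \<eta> x) = (\<lambda>x. conv G a \<xi> x + conv G a \<eta> x)"
  by (auto simp: conv_def sum.distrib distrib_left)

lemma conv_scale_right: "conv G a (\<lambda>x. c * \<xi> x) = (\<lambda>x. c * conv G a \<xi> x)"
  by (auto simp: conv_def sum_distrib_left mult_ac)

lemma conv_diff_right: "conv G a (\<lambda>x. \<xi> x - \<eta> x) = (\<lambda>x. conv G a \<xi> x - conv G a \<eta> x)"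
  by (auto simp: conv_def sum_subtractf right_diff_distrib)

lemma conv_sum_right: "conv G a (\<lambda>x. \<Sum>i\<in>A. \<xi> i x) = (\<lambda>x. \<Sum>i\<in>A. conv G a (\<xi> i) x)"
  by (induction A rule: infinite_finite_induct) (simp_all add: conv_add_right)

lemma conv_add_left:
  assumes "a \<in> grp_alg G" "b \<in> grp_alg G"
  shows "conv G (\<lambda>x. a x + b x) \<xi> = (\<lambda>x. conv G a \<xi> x + conv G b \<xi> x)"
proof
  fix x
  define S where "S = {g. a g \<noteq> 0} \<union> {g. b g \<noteq> 0}"
  have S: "finite S" using assms by (auto simp: S_def grp_alg_def)
  show "conv G (\<lambda>x. a x + b x) \<xi> x = conv G a \<xi> x + conv G b \<xi> x"
  proof (cases "x \<in> carrier G")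
    case True
    then show ?thesis
      using S by (subst (1 2 3) conv_eq_sum[where S=S])
        (auto simp: S_def sum.distrib distrib_right)
  qed (simp add: conv_outside)
qed

lemma conv_diff_left:
  assumes "a \<in> grp_alg G" "b \<in> grp_alg G"
  shows "conv G (\<lambda>x. a x - b x) \<xi> = (\<lambda>x. conv G a \<xi> x - conv G b \<xi> x)"
proof
  fix x
  define S where "S = {g. a g \<noteq> 0} \<union> {g. b g \<noteq> 0}"
  have S: "finite S" using assms by (auto simp: S_def grp_alg_def)
  show "conv G (\<lambda>x. a x - b x) \<xi> x = conv G a \<xi> x - conv G b \<xi> x"
  proof (cases "x \<in> carrier G")
    case True
    then show ?thesis
      using S by (subst (1 2 3) conv_eq_sum[where S=S])
        (auto simp: S_def sum_subtractf left_diff_distrib)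
  qed (simp add: conv_outside)
qed

lemma grp_alg_delta: "g \<in> carrier G \<Longrightarrow> delta g \<in> grp_alg G"
  by (auto simp: grp_alg_def delta_def)

lemma grp_alg_add: "a \<in> grp_alg G \<Longrightarrow> b \<in> grp_alg G \<Longrightarrow> (\<lambda>x. a x + b x) \<in> grp_alg G"
proof -
  assume *: "a \<in> grp_alg G" "b \<in> grp_alg G"
  have "{x. a x + b x \<noteq> 0} \<subseteq> {x. a x \<noteq> 0} \<union> {x. b x \<noteq> 0}" by auto
  with * show ?thesis unfolding grp_alg_def by (auto intro: finite_subset)
qed

lemma grp_alg_diff: "a \<in> grp_alg G \<Longrightarrow> b \<in> grp_alg G \<Longrightarrow> (\<lambda>x. a x - b x) \<in> grp_alg G"
proof -
  assume *: "a \<in> grp_alg G" "b \<in> grp_alg G"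
  have "{x. a x - b x \<noteq> 0} \<subseteq> {x. a x \<noteq> 0} \<union> {x. b x \<noteq> 0}" by auto
  with * show ?thesis unfolding grp_alg_def by (auto intro: finite_subset)
qed

lemma grp_alg_l2: "a \<in> grp_alg G \<Longrightarrow> a \<in> l2 (carrier G)"
  by (auto simp: grp_alg_def intro: l2_finite_support)

lemma grp_alg_outside: "a \<in> grp_alg G \<Longrightarrow> x \<notin> carrier G \<Longrightarrow> a x = 0"
  by (auto simp: grp_alg_def)

lemma inv_mult_eq_one_iff:
  assumes "g \<in> carrier G" "x \<in> carrier G" shows "inv g \<otimes> x = \<one> \<longleftrightarrow> g = x"
proof
  assume "inv g \<otimes> x = \<one>"
  then have "inv x = inv g" using assms by (intro inv_equality) auto
  then show "g = x" using assms by (metis inv_inv)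
qed (use assms in simp)

lemma conv_delta_one_left: "a \<in> grp_alg G \<Longrightarrow> conv G (delta \<one>) a = a"
  by (rule ext, case_tac "x \<in> carrier G")
    (auto simp: conv_outside grp_alg_outside conv_eq_sum[where S="{\<one>}"] delta_def)

lemma conv_delta_one_right:
  assumes "a \<in> grp_alg G" shows "conv G a (delta \<one>) = a"
proof
  fix x
  show "conv G a (delta \<one>) x = a x"
  proof (cases "x \<in> carrier G")
    case True
    have fin: "finite {g. a g \<noteq> 0}" and sub: "{g. a g \<noteq> 0} \<subseteq> carrier G"
      using assms by (auto simp: grp_alg_def)
    \<comment> \<open>Inserting \<open>x\<close> keeps the single surviving index in the range even
      when \<open>a x = 0\<close>.\<close>
    have "conv G a (delta \<one>) x = (\<Sum>g\<in>insert x {g. a g \<noteq> 0}. a g * delta \<one> (inv g \<otimes> x))"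
      using fin True by (intro conv_eq_sum) auto
    also have "\<dots> = (\<Sum>g\<in>insert x {g. a g \<noteq> 0}. if g = x then a g else 0)"
    proof (rule sum.cong[OF refl])
      fix g assume "g \<in> insert x {g. a g \<noteq> 0}"
      then have "g \<in> carrier G" using sub True by auto
      then show "a g * delta \<one> (inv g \<otimes> x) = (if g = x then a g else 0)"
        using True by (auto simp: delta_def inv_mult_eq_one_iff)
    qed
    also have "\<dots> = a x" using fin by simp
    finally show ?thesis .
  qed (simp add: conv_outside grp_alg_outside assms)
qed

lemma star_delta_one: "star G (delta \<one>) = delta \<one>"
  by (rule ext) (auto simp: star_def delta_def)

lemma star_diff: "star G (\<lambda>x. a x - b x) = (\<lambda>x. star G a x - star G b x)"
  by (auto simp: star_def)

lemma bij_left_mult: "g \<in> carrier G \<Longrightarrow> bij_betw (\<lambda>x. g \<otimes> x) (carrier G) (carrier G)"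
  by (rule bij_betwI[where g="\<lambda>x. inv g \<otimes> x"]) (auto simp flip: m_assoc)

lemma bij_right_mult: "g \<in> carrier G \<Longrightarrow> bij_betw (\<lambda>x. x \<otimes> g) (carrier G) (carrier G)"
  by (rule bij_betwI[where g="\<lambda>x. x \<otimes> inv g"]) (auto simp: m_assoc)

lemma l2_inner_translate:
  assumes g: "g \<in> carrier G"
  shows "l2_inner (carrier G) (\<lambda>x. \<xi> (inv g \<otimes> x)) \<eta> = l2_inner (carrier G) \<xi> (\<lambda>x. \<eta> (g \<otimes> x))"
proof -
  have "l2_inner (carrier G) \<xi> (\<lambda>x. \<eta> (g \<otimes> x))
     = l2_inner (carrier G) (\<lambda>x. \<xi> (inv g \<otimes> (g \<otimes> x))) (\<lambda>x. \<eta> (g \<otimes> x))"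
    by (rule l2_cong_inner) (use g in \<open>auto simp flip: m_assoc\<close>)
  also have "\<dots> = l2_inner (carrier G) (\<lambda>x. \<xi> (inv g \<otimes> x)) \<eta>"
    by (rule l2_inner_reindex[OF bij_left_mult[OF g], of "\<lambda>x. \<xi> (inv g \<otimes> x)"])
  finally show ?thesis ..
qed

text \<open>Left translation by \<open>g\<close> has left translation by its inverse as adjoint, and
  \<open>star\<close> inverts the support and conjugates the coefficients; linearity over the finite
  support does the rest.\<close>

lemma l2_inner_conv:
  assumes a: "a \<in> grp_alg G" and \<xi>: "\<xi> \<in> l2 (carrier G)" and \<eta>: "\<eta> \<in> l2 (carrier G)"
  shows "l2_inner (carrier G) (conv G a \<xi>) \<eta> = l2_inner (carrier G) \<xi> (conv G (star G a) \<eta>)"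
proof -
  let ?X = "carrier G"
  let ?S = "{g. a g \<noteq> 0}"
  let ?L = "\<lambda>g \<xi> x. if x \<in> ?X then \<xi> (g \<otimes> x) else 0 :: complex"
  have S: "finite ?S" "?S \<subseteq> ?X" using a by (auto simp: grp_alg_def)
  have L: "?L g \<zeta> \<in> l2 ?X" if "g \<in> ?X" "\<zeta> \<in> l2 ?X" for g \<zeta>
    by (rule l2_bij_compose(1)[OF bij_left_mult[OF that(1)] that(2)])
  have inj: "inj_on (m_inv G) ?S" using S(2) by (intro inj_onI) (metis inv_inv subsetD)
  have sub: "{g. star G a g \<noteq> 0} \<subseteq> m_inv G ` ?S"
    using S(2) by (auto simp: star_def image_iff split: if_splits) (metis inv_inv)
  have c: "conv G (star G a) \<eta> x = (\<Sum>g\<in>?S. cnj (a g) * ?L g \<eta> x)" if "x \<in> ?X" for x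
  proof -
    have "conv G (star G a) \<eta> x = (\<Sum>g\<in>m_inv G ` ?S. star G a g * \<eta> (inv g \<otimes> x))"
      using S sub that by (intro conv_eq_sum) auto
    also have "\<dots> = (\<Sum>g\<in>?S. star G a (inv g) * \<eta> (inv (inv g) \<otimes> x))"
      by (rule sum.reindex[OF inj, unfolded comp_def])
    also have "\<dots> = (\<Sum>g\<in>?S. cnj (a g) * ?L g \<eta> x)"
      using S(2) that by (intro sum.cong) (auto simp: star_def)
    finally show ?thesis .
  qed
  have "l2_inner ?X (conv G a \<xi>) \<eta> = l2_inner ?X (\<lambda>x. \<Sum>g\<in>?S. a g * ?L (inv g) \<xi> x) \<eta>"
    by (rule l2_cong_inner) (auto simp: conv_def)
  also have "\<dots> = (\<Sum>g\<in>?S. a g * l2_inner ?X (?L (inv g) \<xi>) \<eta>)"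
    using S(2) by (subst l2_inner_sum_left) (auto intro!: l2_scale L \<xi> \<eta> simp: l2_inner_scale_left)
  also have "\<dots> = (\<Sum>g\<in>?S. a g * l2_inner ?X \<xi> (?L g \<eta>))"
  proof (intro sum.cong refl arg_cong2[where f="(*)"])
    fix g assume "g \<in> ?S"
    then have g: "g \<in> ?X" using S(2) by auto
    have "l2_inner ?X (?L (inv g) \<xi>) \<eta> = l2_inner ?X (\<lambda>x. \<xi> (inv g \<otimes> x)) \<eta>"
      by (rule l2_cong_inner) auto
    also have "\<dots> = l2_inner ?X \<xi> (\<lambda>x. \<eta> (g \<otimes> x))" by (rule l2_inner_translate[OF g])
    also have "\<dots> = l2_inner ?X \<xi> (?L g \<eta>)" by (rule l2_cong_inner) auto
    finally show "l2_inner ?X (?L (inv g) \<xi>) \<eta> = l2_inner ?X \<xi> (?L g \<eta>)" .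
  qed
  also have "\<dots> = l2_inner ?X \<xi> (\<lambda>x. \<Sum>g\<in>?S. cnj (a g) * ?L g \<eta> x)"
    using S(2) by (subst l2_inner_sum_right) (auto intro!: l2_scale L \<xi> \<eta> simp: l2_inner_scale_right)
  also have "\<dots> = l2_inner ?X \<xi> (conv G (star G a) \<eta>)"
    by (rule l2_cong_inner) (auto simp: c)
  finally show ?thesis .
qed

text \<open>Writing \<open>a\<close> as \<open>a\<close> applied to \<open>delta \<one>\<close> and
  moving it across by adjunction turns inner products into traces.\<close>

lemma l2_inner_grp_alg:
  assumes a: "a \<in> grp_alg G" and b: "b \<in> grp_alg G"
  shows "l2_inner (carrier G) a b = cnj (conv G (star G a) b \<one>)"
proof -
  have "l2_inner (carrier G) a b = l2_inner (carrier G) (conv G a (delta \<one>)) b"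
    by (simp add: conv_delta_one_right a)
  also have "\<dots> = l2_inner (carrier G) (delta \<one>) (conv G (star G a) b)"
    by (intro l2_inner_conv a grp_alg_l2 b l2_delta) simp
  also have "\<dots> = cnj (conv G (star G a) b \<one>)"
    by (subst l2_inner_cnj) (simp add: l2_inner_delta)
  finally show ?thesis .
qed

section \<open>Eigenspaces of left multiplication\<close>

lemma eigspD: "\<xi> \<in> eigsp G T \<mu> \<Longrightarrow> \<xi> \<in> l2 (carrier G)"
  "\<xi> \<in> eigsp G T \<mu> \<Longrightarrow> conv G T \<xi> = (\<lambda>x. complex_of_real \<mu> * \<xi> x)"
  by (auto simp: eigsp_def)

lemma eigsp_zero: "(\<lambda>x. 0) \<in> eigsp G T \<mu>"
  by (auto simp: eigsp_def)

lemma eigsp_add: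
  "\<xi> \<in> eigsp G T \<mu> \<Longrightarrow> \<eta> \<in> eigsp G T \<mu> \<Longrightarrow> (\<lambda>x. \<xi> x + \<eta> x) \<in> eigsp G T \<mu>"
  by (auto simp: eigsp_def conv_add_right l2_add distrib_left)

lemma eigsp_diff:
  "\<xi> \<in> eigsp G T \<mu> \<Longrightarrow> \<eta> \<in> eigsp G T \<mu> \<Longrightarrow> (\<lambda>x. \<xi> x - \<eta> x) \<in> eigsp G T \<mu>"
  by (auto simp: eigsp_def conv_diff_right l2_diff right_diff_distrib)

lemma eigsp_scale: "\<xi> \<in> eigsp G T \<mu> \<Longrightarrow> (\<lambda>x. c * \<xi> x) \<in> eigsp G T \<mu>"
  by (auto simp: eigsp_def conv_scale_right l2_scale mult_ac)

lemma eigsp_sum: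
  "(\<And>i. i \<in> A \<Longrightarrow> \<xi> i \<in> eigsp G T \<mu>) \<Longrightarrow> (\<lambda>x. \<Sum>i\<in>A. \<xi> i x) \<in> eigsp G T \<mu>"
  by (induction A rule: infinite_finite_induct) (auto intro: eigsp_zero eigsp_add)

text \<open>Self-adjointness moves \<open>T\<close> across the inner product; the eigenvalues are
  real, so no conjugation is left.\<close>

lemma eigsp_orthogonal:
  assumes T: "T \<in> grp_alg G" "star G T = T" and "\<mu> \<noteq> \<nu>"
    and \<xi>: "\<xi> \<in> eigsp G T \<mu>" and \<eta>: "\<eta> \<in> eigsp G T \<nu>"
  shows "l2_inner (carrier G) \<xi> \<eta> = 0"
proof -
  have "of_real \<mu> * l2_inner (carrier G) \<xi> \<eta> = l2_inner (carrier G) (conv G T \<xi>) \<eta>"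
    by (simp add: eigspD[OF \<xi>] l2_inner_scale_left)
  also have "\<dots> = l2_inner (carrier G) \<xi> (conv G T \<eta>)"
    by (subst l2_inner_conv) (simp_all add: T eigspD[OF \<xi>] eigspD[OF \<eta>])
  also have "\<dots> = of_real \<nu> * l2_inner (carrier G) \<xi> \<eta>"
    by (simp add: eigspD[OF \<eta>] l2_inner_scale_right)
  finally show ?thesis using \<open>\<mu> \<noteq> \<nu>\<close> by simp
qed

text \<open>\<open>orth_proj\<close> is a definite description, so uniqueness is required too: the
  difference of two candidates lies in the eigenspace and is orthogonal to itself.\<close>

lemma orth_proj_eigsp_eqI:
  assumes k: "k \<in> eigsp G T \<mu>" and \<xi>: "\<xi> \<in> l2 (carrier G)"
    and orth: "\<And>\<eta>. \<eta> \<in> eigsp G T \<mu> \<Longrightarrow> l2_inner (carrier G) (\<lambda>x. \<xi> x - k x) \<eta> = 0"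
  shows "orth_proj (carrier G) (eigsp G T \<mu>) \<xi> = k"
  unfolding orth_proj_def
proof (rule the_equality)
  let ?X = "carrier G"
  fix k' assume k': "k' \<in> eigsp G T \<mu> \<and> (\<forall>\<eta>\<in>eigsp G T \<mu>. l2_inner ?X (\<lambda>x. \<xi> x - k' x) \<eta> = 0)"
  define d where "d = (\<lambda>x. k x - k' x)"
  have d: "d \<in> eigsp G T \<mu>" unfolding d_def using k k' by (intro eigsp_diff) auto
  have "l2_inner ?X d d = l2_inner ?X (\<lambda>x. (\<xi> x - k' x) - (\<xi> x - k x)) d"
    by (simp add: d_def)
  also have "\<dots> = 0"
    using k k' d \<xi> by (subst l2_inner_diff_left) (auto simp: orth intro!: l2_diff dest: eigspD)
  finally have "d = (\<lambda>x. 0)" using d by (intro l2_inner_self_eq_0) (auto dest: eigspD)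
  then show "k' = k" unfolding d_def by (simp add: fun_eq_iff)
qed (use k orth in auto)

text \<open>By associativity, left multiplication commutes with right translation.\<close>

lemma eigsp_translate:
  assumes g: "g \<in> carrier G" and T: "T \<in> grp_alg G" and \<xi>: "\<xi> \<in> eigsp G T \<mu>"
  shows "(\<lambda>x. if x \<in> carrier G then \<xi> (x \<otimes> g) else 0) \<in> eigsp G T \<mu>"
proof -
  have "conv G T (\<lambda>x. if x \<in> carrier G then \<xi> (x \<otimes> g) else 0) x
     = of_real \<mu> * (if x \<in> carrier G then \<xi> (x \<otimes> g) else 0)" for x
  proof (cases "x \<in> carrier G")
    case True
    have "conv G T (\<lambda>x. if x \<in> carrier G then \<xi> (x \<otimes> g) else 0) x = conv G T \<xi> (x \<otimes> g)"
      using T g True by (auto simp: conv_def grp_alg_def m_assoc subset_iff intro!: sum.cong)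
    then show ?thesis using True by (simp add: eigspD[OF \<xi>])
  qed (simp add: conv_outside)
  then show ?thesis
    using l2_bij_compose(1)[OF bij_right_mult[OF g] eigspD(1)[OF \<xi>]] by (auto simp: eigsp_def)
qed

section \<open>The algebraic sum of the eigenspaces and its density\<close>

definition eigspan :: "('a \<Rightarrow> complex) \<Rightarrow> ('a \<Rightarrow> complex) set" where
  "eigspan T = {\<zeta>. \<exists>F \<eta>. finite F \<and> (\<forall>\<mu>\<in>F. \<eta> \<mu> \<in> eigsp G T \<mu>) \<and> \<zeta> = (\<lambda>x. \<Sum>\<mu>\<in>F. \<eta> \<mu> x)}"

lemma eigspan_l2: "\<zeta> \<in> eigspan T \<Longrightarrow> \<zeta> \<in> l2 (carrier G)"
  by (auto simp: eigspan_def intro!: l2_sum dest: eigspD)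

lemma eigspan_eigsp: "\<zeta> \<in> eigsp G T \<mu> \<Longrightarrow> \<zeta> \<in> eigspan T"
  unfolding eigspan_def by (auto intro!: exI[of _ "{\<mu>}"] exI[of _ "\<lambda>_. \<zeta>"])

lemma eigspan_scale:
  assumes "\<zeta> \<in> eigspan T" shows "(\<lambda>x. c * \<zeta> x) \<in> eigspan T"
proof -
  obtain F \<eta> where "finite F" "\<forall>\<mu>\<in>F. \<eta> \<mu> \<in> eigsp G T \<mu>" "\<zeta> = (\<lambda>x. \<Sum>\<mu>\<in>F. \<eta> \<mu> x)"
    using assms by (auto simp: eigspan_def)
  then show ?thesis unfolding eigspan_def
    by (auto intro!: exI[of _ F] exI[of _ "\<lambda>\<mu> x. c * \<eta> \<mu> x"] eigsp_scale simp: sum_distrib_left)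
qed

lemma eigspan_add:
  assumes "\<zeta> \<in> eigspan T" "\<zeta>' \<in> eigspan T" shows "(\<lambda>x. \<zeta> x + \<zeta>' x) \<in> eigspan T"
proof -
  obtain F \<eta> where F: "finite F" "\<forall>\<mu>\<in>F. \<eta> \<mu> \<in> eigsp G T \<mu>" "\<zeta> = (\<lambda>x. \<Sum>\<mu>\<in>F. \<eta> \<mu> x)"
    using assms by (auto simp: eigspan_def)
  obtain F' \<eta>' where F': "finite F'" "\<forall>\<mu>\<in>F'. \<eta>' \<mu> \<in> eigsp G T \<mu>" "\<zeta>' = (\<lambda>x. \<Sum>\<mu>\<in>F'. \<eta>' \<mu> x)"
    using assms by (auto simp: eigspan_def)
  \<comment> \<open>Both families are extended by zero to the union, so that an eigenvalue occurring
    in both receives the sum of its two vectors.\<close>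
  let ?\<eta> = "\<lambda>\<mu> x. (if \<mu> \<in> F then \<eta> \<mu> x else 0) + (if \<mu> \<in> F' then \<eta>' \<mu> x else 0)"
  have "(\<lambda>x. \<zeta> x + \<zeta>' x) = (\<lambda>x. \<Sum>\<mu>\<in>F \<union> F'. ?\<eta> \<mu> x)"
    unfolding F(3) F'(3) sum.distrib using F(1) F'(1)
    by (intro ext arg_cong2[where f="(+)"] sum.mono_neutral_cong_left) auto
  moreover have "?\<eta> \<mu> \<in> eigsp G T \<mu>" if "\<mu> \<in> F \<union> F'" for \<mu>
  proof (intro eigsp_add)
    show "(\<lambda>x. if \<mu> \<in> F then \<eta> \<mu> x else 0) \<in> eigsp G T \<mu>" using F(2) by (cases "\<mu> \<in> F") (auto intro: eigsp_zero)
    show "(\<lambda>x. if \<mu> \<in> F' then \<eta>' \<mu> x else 0) \<in> eigsp G T \<mu>" using F'(2) by (cases "\<mu> \<in> F'") (auto intro: eigsp_zero)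
  qed
  ultimately show ?thesis unfolding eigspan_def using F(1) F'(1)
    by (auto intro!: exI[of _ "F \<union> F'"] exI[of _ ?\<eta>])
qed

lemma eigspan_sum:
  "(\<And>i. i \<in> A \<Longrightarrow> \<zeta> i \<in> eigspan T) \<Longrightarrow> (\<lambda>x. \<Sum>i\<in>A. \<zeta> i x) \<in> eigspan T"
  by (induction A rule: infinite_finite_induct)
    (auto intro: eigspan_add eigspan_eigsp[OF eigsp_zero])

lemma eigspan_translate:
  assumes g: "g \<in> carrier G" and T: "T \<in> grp_alg G" and \<zeta>: "\<zeta> \<in> eigspan T"
  shows "(\<lambda>x. if x \<in> carrier G then \<zeta> (x \<otimes> g) else 0) \<in> eigspan T"
proof -
  obtain F \<eta> where F: "finite F" "\<forall>\<mu>\<in>F. \<eta> \<mu> \<in> eigsp G T \<mu>" "\<zeta> = (\<lambda>x. \<Sum>\<mu>\<in>F. \<eta> \<mu> x)"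
    using \<zeta> by (auto simp: eigspan_def)
  show ?thesis unfolding eigspan_def
    by (rule CollectI, rule exI[of _ F], rule exI[of _ "\<lambda>\<mu> x. if x \<in> carrier G then \<eta> \<mu> (x \<otimes> g) else 0"])
      (use F eigsp_translate[OF g T] in auto)
qed

text \<open>Right translations commute with left multiplication by \<open>T\<close>, so it suffices to
  approximate \<open>\<delta>\<^sub>1\<close>.\<close>

lemma eigspan_dense:
  assumes T: "T \<in> grp_alg G"
    and one: "\<And>\<epsilon>. \<epsilon> > 0 \<Longrightarrow> \<exists>\<zeta>\<in>eigspan T. l2_norm (carrier G) (\<lambda>x. delta \<one> x - \<zeta> x) < \<epsilon>"
    and \<xi>: "\<xi> \<in> l2 (carrier G)" and "\<epsilon> > 0"
  shows "\<exists>\<zeta>\<in>eigspan T. l2_norm (carrier G) (\<lambda>x. \<xi> x - \<zeta> x) < \<epsilon>"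
proof -
  let ?X = "carrier G"
  obtain F where F: "finite F" "F \<subseteq> ?X"
    and F_lt: "l2_norm ?X (\<lambda>x. \<xi> x - (\<Sum>g\<in>F. \<xi> g * delta g x)) < \<epsilon> / 2"
    using l2_finite_approx[OF \<xi>, of "\<epsilon> / 2"] \<open>\<epsilon> > 0\<close> by auto
  \<comment> \<open>The error made at \<open>delta \<one>\<close> is multiplied by at most the sum
    of the \<open>cmod (\<xi> g)\<close>; the extra 1 keeps the divisor positive.\<close>
  define C where "C = (\<Sum>g\<in>F. cmod (\<xi> g)) + 1"
  have C: "C > 0" unfolding C_def by (simp add: add_nonneg_pos sum_nonneg)
  obtain \<zeta> where \<zeta>: "\<zeta> \<in> eigspan T" "l2_norm ?X (\<lambda>x. delta \<one> x - \<zeta> x) < \<epsilon> / (2 * C)"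
    using one[of "\<epsilon> / (2 * C)"] C \<open>\<epsilon> > 0\<close> by auto
  \<comment> \<open>Right translation that carries \<open>delta \<one>\<close> to
    \<open>delta g\<close> and preserves the norm.\<close>
  let ?R = "\<lambda>g \<zeta> x. if x \<in> ?X then \<zeta> (x \<otimes> inv g) else 0 :: complex"
  let ?d = "\<lambda>x. delta \<one> x - \<zeta> x"
  define Z where "Z = (\<lambda>x. \<Sum>g\<in>F. \<xi> g * ?R g \<zeta> x)"
  have Z: "Z \<in> eigspan T" unfolding Z_def using F
    by (intro eigspan_sum eigspan_scale eigspan_translate \<zeta> T) auto
  have d: "?d \<in> l2 ?X" by (intro l2_diff l2_delta eigspan_l2[OF \<zeta>(1)]) simp
  have Rd: "?R g ?d \<in> l2 ?X" "l2_norm ?X (?R g ?d) = l2_norm ?X ?d" if "g \<in> F" for g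
    using l2_bij_compose[OF bij_right_mult d, of "inv g"] F that by auto
  have del: "delta g x = ?R g (delta \<one>) x" if "g \<in> F" for g x
  proof -
    have g: "g \<in> ?X" using F that by auto
    have "x = g" if "x \<in> ?X" "x \<otimes> inv g = \<one>"
    proof -
      have "inv (inv g) = x" using that g by (intro inv_equality) auto
      then show ?thesis using g by simp
    qed
    then show ?thesis using g by (auto simp: delta_def)
  qed
  have eq: "(\<Sum>g\<in>F. \<xi> g * delta g x) - Z x = (\<Sum>g\<in>F. \<xi> g * ?R g ?d x)" for x
    unfolding Z_def sum_subtractf[symmetric]
    by (intro sum.cong refl) (auto simp: del right_diff_distrib)
  have "l2_norm ?X (\<lambda>x. \<Sum>g\<in>F. \<xi> g * ?R g ?d x) \<le> (\<Sum>g\<in>F. l2_norm ?X (\<lambda>x. \<xi> g * ?R g ?d x))"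
    by (intro l2_norm_sum_le l2_scale Rd)
  also have "\<dots> = (\<Sum>g\<in>F. cmod (\<xi> g)) * l2_norm ?X ?d"
    unfolding l2_norm_scale by (simp add: Rd sum_distrib_right)
  also have "\<dots> \<le> C * l2_norm ?X ?d"
    by (intro mult_right_mono) (auto simp: C_def)
  also have "\<dots> < C * (\<epsilon> / (2 * C))" using \<zeta>(2) C by (intro mult_strict_left_mono)
  also have "\<dots> = \<epsilon> / 2" using C by simp
  finally have 2: "l2_norm ?X (\<lambda>x. (\<Sum>g\<in>F. \<xi> g * delta g x) - Z x) < \<epsilon> / 2" by (simp add: eq)
  have f: "(\<lambda>x. \<Sum>g\<in>F. \<xi> g * delta g x) \<in> l2 ?X" using F by (intro l2_sum l2_scale l2_delta) auto
  have "l2_norm ?X (\<lambda>x. (\<xi> x - (\<Sum>g\<in>F. \<xi> g * delta g x)) + ((\<Sum>g\<in>F. \<xi> g * delta g x) - Z x)) < \<epsilon>"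
    using l2_norm_triangle[OF l2_diff[OF \<xi> f] l2_diff[OF f eigspan_l2[OF Z]]] F_lt 2 by linarith
  then have "l2_norm ?X (\<lambda>x. \<xi> x - Z x) < \<epsilon>" by simp
  with Z show ?thesis by blast
qed

text \<open>The sum defining \<open>conv G T\<close> at a point is finite, so the eigenvalue
  equation passes to the limit pointwise.\<close>

lemma eigsp_suminf:
  assumes ev: "\<And>n. \<xi> n \<in> eigsp G T \<mu>" and bd: "\<And>n. l2_norm (carrier G) (\<xi> n) \<le> c n" and sm: "summable c"
  shows "(\<lambda>x. \<Sum>n. \<xi> n x) \<in> eigsp G T \<mu>"
proof -
  define k where "k = (\<lambda>x. \<Sum>n::nat. \<xi> n x)"
  note l2 = eigspD(1)[OF ev]
  have s: "(\<lambda>n. \<xi> n x) sums k x" for x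
    unfolding k_def by (rule l2_suminf_sums[OF l2 bd sm])
  have "conv G T k x = of_real \<mu> * k x" for x
  proof (cases "x \<in> carrier G")
    case True
    have "(\<lambda>n. conv G T (\<xi> n) x) sums conv G T k x"
      using True unfolding conv_def by (auto intro!: sums_sum sums_mult s)
    moreover have "(\<lambda>n. conv G T (\<xi> n) x) sums (of_real \<mu> * k x)"
      unfolding eigspD(2)[OF ev] by (intro sums_mult s)
    ultimately show ?thesis by (rule sums_unique2)
  next
    case False
    have "k x = 0" unfolding k_def by (simp add: l2_outside[OF l2 False])
    then show ?thesis using False by (simp add: conv_outside)
  qed
  then show ?thesis
    using l2_suminf_in_l2[OF l2 bd sm] unfolding k_def[symmetric] by (auto simp: eigsp_def)
qed

end

section \<open>Elementary tensors over the wreath product\<close>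

lemma wreath_Z_simps [simp]:
  "carrier (wreath_Z U) = {(f,k). (\<forall>n. f n \<in> carrier U) \<and> finite {n. f n \<noteq> \<one>\<^bsub>U\<^esub>}}"
  "mult (wreath_Z U) (f, k) (g, l) = (\<lambda>n. f n \<otimes>\<^bsub>U\<^esub> g (n + k), k + l)"
  "one (wreath_Z U) = (\<lambda>n. \<one>\<^bsub>U\<^esub>, 0)"
  by (simp_all add: wreath_Z_def)

lemma finite_shift:
  fixes k :: int
  assumes "finite {n. P n}" shows "finite {n. P (n + k)}"
proof -
  have "{n. P (n + k)} = (\<lambda>n. n - k) ` {n. P n}" by (auto simp: image_iff) (metis add_diff_cancel)
  then show ?thesis using assms by simp
qed

context group
begin

lemma wreath_Z_mult_closed:
  assumes "x \<in> carrier (wreath_Z G)" "y \<in> carrier (wreath_Z G)"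
  shows "x \<otimes>\<^bsub>wreath_Z G\<^esub> y \<in> carrier (wreath_Z G)"
proof -
  obtain f k g l where x: "x = (f, k)" "y = (g, l)" by fastforce
  have f: "finite {n. f n \<noteq> \<one>}" "\<And>n. f n \<in> carrier G"
    and g: "finite {n. g n \<noteq> \<one>}" "\<And>n. g n \<in> carrier G" using assms by (auto simp: x)
  have "finite ({n. f n \<noteq> \<one>} \<union> {n. g (n + k) \<noteq> \<one>})"
    using f(1) finite_shift[OF g(1)] by simp
  moreover have "{n. f n \<otimes> g (n + k) \<noteq> \<one>} \<subseteq> {n. f n \<noteq> \<one>} \<union> {n. g (n + k) \<noteq> \<one>}" by auto
  ultimately have "finite {n. f n \<otimes> g (n + k) \<noteq> \<one>}" by (rule finite_subset[rotated])
  then show ?thesis using f g by (simp add: x)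
qed

lemma wreath_Z_inv_closed:
  assumes "(f, k) \<in> carrier (wreath_Z G)"
  shows "(\<lambda>n. inv (f (n - k)), - k) \<in> carrier (wreath_Z G)"
proof -
  have "finite {n. f (n + - k) \<noteq> \<one>}" using assms by (intro finite_shift) auto
  moreover have "{n. inv (f (n - k)) \<noteq> \<one>} \<subseteq> {n. f (n + - k) \<noteq> \<one>}" by auto
  ultimately have "finite {n. inv (f (n - k)) \<noteq> \<one>}" by (rule finite_subset[rotated])
  then show ?thesis using assms by simp
qed

lemma group_wreath_Z: "group (wreath_Z G)"
proof (rule groupI)
  fix x assume "x \<in> carrier (wreath_Z G)"
  then obtain f k where x: "x = (f, k)" "(f, k) \<in> carrier (wreath_Z G)" by (cases x) auto
  show "\<exists>y\<in>carrier (wreath_Z G). y \<otimes>\<^bsub>wreath_Z G\<^esub> x = \<one>\<^bsub>wreath_Z G\<^esub>"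
    by (rule bexI[OF _ wreath_Z_inv_closed[OF x(2)]]) (use x in auto)
qed (auto simp: m_assoc add.assoc intro: wreath_Z_mult_closed simp del: wreath_Z_simps(1), auto simp: m_assoc ac_simps)

interpretation W: group "wreath_Z G" by (rule group_wreath_Z)

lemma wreath_Z_inv:
  assumes "(f, k) \<in> carrier (wreath_Z G)"
  shows "inv\<^bsub>wreath_Z G\<^esub> (f, k) = (\<lambda>n. inv (f (n - k)), - k)"
  using assms by (intro W.inv_equality wreath_Z_inv_closed) auto

section \<open>Tensors: support, product and adjoint\<close>

definition tensor_family :: "(int \<Rightarrow> 'a \<Rightarrow> complex) \<Rightarrow> bool" where
  "tensor_family c \<longleftrightarrow> (\<forall>i. c i \<in> grp_alg G) \<and> finite {i. c i \<noteq> delta \<one>}"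

text \<open>This is the element \<open>(\<Otimes>\<^sub>i c i) t\<^sup>k\<close>; the product only ranges over the finitely many factors
  different from \<open>1\<close>.\<close>

definition tensor :: "(int \<Rightarrow> 'a \<Rightarrow> complex) \<Rightarrow> int \<Rightarrow> (int \<Rightarrow> 'a) \<times> int \<Rightarrow> complex" where
  "tensor c k = (\<lambda>(f, l). if l = k \<and> (f, l) \<in> carrier (wreath_Z G)
     then (\<Prod>i | c i (f i) \<noteq> 1. c i (f i)) else 0)"

text \<open>Factors equal to 1 may be added, so several tensors can be evaluated over one common
  finite set of sites.\<close>

lemma tensor_eq_prod:
  assumes "(f, k) \<in> carrier (wreath_Z G)" "finite I" "\<And>i. i \<notin> I \<Longrightarrow> c i (f i) = 1"
  shows "tensor c k (f, k) = (\<Prod>i\<in>I. c i (f i))"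
proof -
  have "(\<Prod>i | c i (f i) \<noteq> 1. c i (f i)) = (\<Prod>i\<in>I. c i (f i))"
    using assms by (intro prod.mono_neutral_left) auto
  then show ?thesis using assms(1) by (simp add: tensor_def del: wreath_Z_simps)
qed

lemma tensor_outside: "x \<notin> carrier (wreath_Z G) \<Longrightarrow> tensor c k x = 0"
  unfolding tensor_def by (cases x) (simp del: wreath_Z_simps)

lemma tensor_other: "l \<noteq> k \<Longrightarrow> tensor c k (f, l) = 0"
  by (simp add: tensor_def)

text \<open>The last claim holds at every site: on a finite index set because the product is
  nonzero, elsewhere because the factor is 1.\<close>

lemma tensor_nonzeroD:
  assumes c: "tensor_family c" and nz: "tensor c k (f, l) \<noteq> 0"
  shows "l = k" "(f, l) \<in> carrier (wreath_Z G)" "c i (f i) \<noteq> 0"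
proof -
  show l: "l = k" and f: "(f, l) \<in> carrier (wreath_Z G)"
    using nz by (auto simp: tensor_def simp del: wreath_Z_simps split: if_splits)
  let ?I = "{i. c i \<noteq> delta \<one>} \<union> {i. f i \<noteq> \<one>}"
  have I: "finite ?I" using c f by (auto simp: tensor_family_def)
  have o: "c i (f i) = 1" if "i \<notin> ?I" for i using that by (auto simp: delta_def)
  have "tensor c k (f, k) = (\<Prod>i\<in>?I. c i (f i))"
    using f l I o by (intro tensor_eq_prod) auto
  then have "\<forall>i\<in>?I. c i (f i) \<noteq> 0" using nz l I by simp
  then show "c i (f i) \<noteq> 0" using o[of i] by (cases "i \<in> ?I") auto
qed

lemma tensor_zero:
  assumes "tensor_family c" "c i = (\<lambda>x. 0)" shows "tensor c k = (\<lambda>x. 0)"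
proof
  fix x show "tensor c k x = 0"
    using tensor_nonzeroD(3)[OF assms(1), of k "fst x" "snd x" i] assms(2) by auto
qed

lemma tensor_grp_alg:
  assumes c: "tensor_family c" shows "tensor c k \<in> grp_alg (wreath_Z G)"
proof -
  let ?I = "{i. c i \<noteq> delta \<one>}"
  let ?P = "PiE ?I (\<lambda>i. {u. c i u \<noteq> 0})"
  have fin: "finite ?P" using c by (intro finite_PiE) (auto simp: tensor_family_def grp_alg_def)
  \<comment> \<open>Off \<open>?I\<close> a nonzero value forces a trivial component, so a support
    element is determined by its restriction to \<open>?I\<close>.\<close>
  have "{x. tensor c k x \<noteq> 0} \<subseteq> (\<lambda>p. (\<lambda>i. if i \<in> ?I then p i else \<one>, k)) ` ?P"
  proof
    fix x assume x: "x \<in> {x. tensor c k x \<noteq> 0}"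
    obtain f l where fl: "x = (f, l)" by (cases x)
    note D = tensor_nonzeroD[OF c, of k f l]
    have nz: "tensor c k (f, l) \<noteq> 0" using x fl by simp
    have "x = (\<lambda>i. if i \<in> ?I then restrict f ?I i else \<one>, k)"
      using D[OF nz] unfolding fl by (auto simp: delta_def fun_eq_iff split: if_splits)
    moreover have "restrict f ?I \<in> ?P" using D(3)[OF nz] by auto
    ultimately show "x \<in> (\<lambda>p. (\<lambda>i. if i \<in> ?I then p i else \<one>, k)) ` ?P" by blast
  qed
  then have "finite {x. tensor c k x \<noteq> 0}" using fin by (auto intro: finite_subset)
  moreover have "{x. tensor c k x \<noteq> 0} \<subseteq> carrier (wreath_Z G)" using tensor_outside[of _ c k] by (auto simp del: wreath_Z_simps)
  ultimately show ?thesis by (simp add: grp_alg_def del: wreath_Z_simps)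
qed

text \<open>A sum of products of one-site terms, taken over all choices of one group element per
  site, factors into one-site sums, which are convolutions over \<open>G\<close>. Moving
  \<open>t\<^sup>k\<close> past \<open>d\<close> causes the shift by \<open>k\<close>.\<close>

lemma tensor_conv:
  assumes c: "tensor_family c" and d: "tensor_family d"
  shows "conv (wreath_Z G) (tensor c k) (tensor d l)
       = tensor (\<lambda>i. conv G (c i) (d (i + k))) (k + l)"
proof
  fix x :: "(int \<Rightarrow> 'a) \<times> int"
  let ?W = "wreath_Z G"
  let ?cd = "\<lambda>i. conv G (c i) (d (i + k))"
  obtain h m where x: "x = (h, m)" by (cases x)
  show "conv ?W (tensor c k) (tensor d l) x = tensor ?cd (k + l) x"
  proof (cases "x \<in> carrier ?W")
    case hm: True
    have h: "\<And>i. h i \<in> carrier G" "finite {i. h i \<noteq> \<one>}" using hm by (auto simp: x)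
    show ?thesis
    proof (cases "m = k + l")
      case True
      \<comment> \<open>Outside \<open>I\<close> both tensor factors and \<open>h\<close> are
        trivial, so all products may be restricted to \<open>I\<close>.\<close>
      define I where "I = {i. c i \<noteq> delta \<one>} \<union> {i. d (i + k) \<noteq> delta \<one>} \<union> {i. h i \<noteq> \<one>}"
      have I: "finite I"
        unfolding I_def using c d h by (auto simp: tensor_family_def intro: finite_shift)
      have outI: "c i = delta \<one>" "d (i + k) = delta \<one>" "h i = \<one>" if "i \<notin> I" for i
        using that by (auto simp: I_def)
      define B where "B = (\<lambda>i. {u. c i u \<noteq> 0})"
      have B: "finite (B i)" "B i \<subseteq> carrier G" for i
        using c by (auto simp: B_def tensor_family_def grp_alg_def)
      \<comment> \<open>Extends a choice on \<open>I\<close> to the whole line by the neutral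
        element; these extensions cover the support of the left tensor.\<close>
      define q where "q = (\<lambda>p i. if i \<in> I then p i else \<one>)"
      have q: "(q p, k) \<in> carrier ?W" if "p \<in> PiE I B" for p
      proof -
        have "{n. q p n \<noteq> \<one>} \<subseteq> I" by (auto simp: q_def)
        then have "finite {n. q p n \<noteq> \<one>}" using I by (rule finite_subset)
        moreover have "q p n \<in> carrier G" for n using that B(2) by (auto simp: q_def dest: PiE_mem)
        ultimately show ?thesis by simp
      qed
      have inj: "inj_on (\<lambda>p. (q p, k)) (PiE I B)"
        by (rule inj_onI, rule PiE_ext) (auto simp: q_def fun_eq_iff, metis)
      have sub: "{g. tensor c k g \<noteq> 0} \<subseteq> (\<lambda>p. (q p, k)) ` PiE I B"
      proof
        fix g assume g: "g \<in> {g. tensor c k g \<noteq> 0}"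
        obtain f l' where f: "g = (f, l')" by (cases g)
        have nz: "tensor c k (f, l') \<noteq> 0" using g f by simp
        note D = tensor_nonzeroD[OF c nz]
        have "f i = \<one>" if "i \<notin> I" for i
          using D(3)[of i] outI(1)[OF that] by (auto simp: delta_def split: if_splits)
        then have "g = (q (restrict f I), k)" using D(1) by (auto simp: f q_def)
        moreover have "restrict f I \<in> PiE I B" using D(3) by (auto simp: B_def)
        ultimately show "g \<in> (\<lambda>p. (q p, k)) ` PiE I B" by blast
      qed
      have c_eq: "tensor c k (q p, k) = (\<Prod>i\<in>I. c i (p i))" if "p \<in> PiE I B" for p
        by (subst tensor_eq_prod[OF q[OF that] I]) (auto simp: q_def outI delta_def)
      have d_eq: "tensor d l (inv\<^bsub>?W\<^esub> (q p, k) \<otimes>\<^bsub>?W\<^esub> x) = (\<Prod>i\<in>I. d (i + k) (inv (p i) \<otimes> h i))"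
        if p: "p \<in> PiE I B" for p
      proof -
        let ?r = "\<lambda>n. inv (q p (n - k)) \<otimes> h (n - k)"
        have eq: "inv\<^bsub>?W\<^esub> (q p, k) \<otimes>\<^bsub>?W\<^esub> x = (?r, l)"
          unfolding x by (simp add: wreath_Z_inv[OF q[OF p]] True)
        have car: "(?r, l) \<in> carrier ?W"
          unfolding eq[symmetric] by (intro wreath_Z_mult_closed hm W.inv_closed q p)
        have "tensor d l (?r, l) = (\<Prod>n\<in>(\<lambda>i. i + k) ` I. d n (?r n))"
        proof (rule tensor_eq_prod[OF car])
          fix n assume "n \<notin> (\<lambda>i. i + k) ` I"
          then have "n - k \<notin> I" by (metis diff_add_cancel imageI)
          then show "d n (?r n) = 1" using outI[of "n - k"] by (simp add: q_def delta_def)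
        qed (use I in simp)
        also have "\<dots> = (\<Prod>i\<in>I. d (i + k) (?r (i + k)))"
          by (rule prod.reindex[unfolded comp_def]) simp
        also have "\<dots> = (\<Prod>i\<in>I. d (i + k) (inv (p i) \<otimes> h i))" by (simp add: q_def)
        finally show ?thesis by (simp only: eq)
      qed
      have "conv ?W (tensor c k) (tensor d l) x
          = (\<Sum>g\<in>(\<lambda>p. (q p, k)) ` PiE I B. tensor c k g * tensor d l (inv\<^bsub>?W\<^esub> g \<otimes>\<^bsub>?W\<^esub> x))"
        by (rule W.conv_eq_sum[OF _ sub hm]) (intro finite_imageI finite_PiE I B)
      also have "\<dots> = (\<Sum>p\<in>PiE I B. tensor c k (q p, k) * tensor d l (inv\<^bsub>?W\<^esub> (q p, k) \<otimes>\<^bsub>?W\<^esub> x))"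
        by (rule sum.reindex[OF inj, unfolded comp_def])
      also have "\<dots> = (\<Sum>p\<in>PiE I B. \<Prod>i\<in>I. c i (p i) * d (i + k) (inv (p i) \<otimes> h i))"
        by (intro sum.cong refl) (simp only: c_eq d_eq prod.distrib)
      \<comment> \<open>Distributivity: the elements of \<open>PiE I B\<close> are the choices of
        one \<open>u\<close> per site.\<close>
      also have "\<dots> = (\<Prod>i\<in>I. \<Sum>u\<in>B i. c i u * d (i + k) (inv u \<otimes> h i))"
        by (rule prod_sum_PiE[symmetric, OF I B(1)])
      also have "\<dots> = (\<Prod>i\<in>I. ?cd i (h i))"
        by (simp add: conv_def B_def h)
      also have "\<dots> = tensor ?cd (k + l) x"
        unfolding x True
      proof (rule tensor_eq_prod[symmetric, OF _ I])
        fix i assume "i \<notin> I"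
        then show "?cd i (h i) = 1"
          by (simp add: outI conv_delta_one_left grp_alg_delta) (simp add: delta_def)
      qed (use hm x True in simp)
      finally show ?thesis .
    next
      case False
      \<comment> \<open>The translated point carries the power \<open>m - k\<close> of
        \<open>t\<close>, which is not \<open>l\<close>.\<close>
      have "tensor d l (inv\<^bsub>?W\<^esub> g \<otimes>\<^bsub>?W\<^esub> x) = 0" if nz: "tensor c k g \<noteq> 0" for g
      proof -
        obtain f l' where f: "g = (f, l')" by (cases g)
        have nz: "tensor c k (f, l') \<noteq> 0" using nz f by simp
        note D = tensor_nonzeroD[OF c nz]
        show ?thesis unfolding f x wreath_Z_inv[OF D(2)] using False D(1) by (simp add: tensor_other)
      qed
      then show ?thesis using hm False by (simp add: conv_def x tensor_other)
    qed
  qed (simp add: W.conv_outside tensor_outside del: wreath_Z_simps)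
qed

text \<open>The adjoint puts \<open>t\<^sup>-\<^sup>k\<close> on the left; moving it back to the
  right of the factors shifts them by \<open>k\<close> sites.\<close>

lemma tensor_star:
  assumes c: "tensor_family c"
  shows "star (wreath_Z G) (tensor c k) = tensor (\<lambda>i. star G (c (i - k))) (- k)"
proof
  fix x :: "(int \<Rightarrow> 'a) \<times> int"
  let ?W = "wreath_Z G"
  obtain f l where x: "x = (f, l)" by (cases x)
  show "star ?W (tensor c k) x = tensor (\<lambda>i. star G (c (i - k))) (- k) x"
  proof (cases "x \<in> carrier ?W \<and> l = - k")
    case True
    have f: "\<And>i. f i \<in> carrier G" "finite {i. f i \<noteq> \<one>}" using True by (auto simp: x)
    have car: "(f, - k) \<in> carrier ?W" using True x by blast
    have car': "(\<lambda>n. inv (f (n + k)), k) \<in> carrier ?W" using wreath_Z_inv_closed[OF car] by simp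
    define I where "I = {i. c i \<noteq> delta \<one>} \<union> {i. f (i + k) \<noteq> \<one>}"
    have I: "finite I"
      unfolding I_def using c f by (auto simp: tensor_family_def intro: finite_shift)
    have outI: "c i = delta \<one>" "f (i + k) = \<one>" if "i \<notin> I" for i
      using that by (auto simp: I_def)
    have "star ?W (tensor c k) x = cnj (tensor c k (\<lambda>n. inv (f (n + k)), k))"
      using True wreath_Z_inv[OF car] by (simp add: star_def x)
    also have "\<dots> = cnj (\<Prod>i\<in>I. c i (inv (f (i + k))))"
      by (subst tensor_eq_prod[OF car' I]) (auto simp: outI delta_def)
    also have "\<dots> = (\<Prod>i\<in>I. star G (c (i + k - k)) (f (i + k)))"
      using f by (simp add: star_def cnj_prod)
    also have "\<dots> = (\<Prod>n\<in>(\<lambda>i. i + k) ` I. star G (c (n - k)) (f n))"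
      by (rule prod.reindex[unfolded comp_def, symmetric]) simp
    also have "\<dots> = tensor (\<lambda>i. star G (c (i - k))) (- k) (f, - k)"
    proof (rule tensor_eq_prod[OF car, symmetric])
      fix n assume "n \<notin> (\<lambda>i. i + k) ` I"
      then have "n - k \<notin> I" by (metis diff_add_cancel imageI)
      then show "star G (c (n - k)) (f n) = 1"
        using outI[of "n - k"] by (simp add: star_delta_one) (simp add: delta_def)
    qed (use I in simp)
    finally show ?thesis using True x by simp
  next
    case False
    show ?thesis
    proof (cases "x \<in> carrier ?W")
      case True
      then have "l \<noteq> - k" using False by simp
      then show ?thesis
        using True wreath_Z_inv[of f l] unfolding star_def x
        by (simp add: tensor_other)
    qed (simp add: star_def tensor_outside del: wreath_Z_simps)
  qed
qed

text \<open>With trivial factors a tensor is a power of \<open>t\<close>, so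
  \<open>tensor_conv\<close> also covers multiplication by \<open>t\<close> and its inverse.\<close>

lemma tensor_delta: "tensor (\<lambda>i. delta \<one>) k = delta (\<lambda>n. \<one>, k)"
proof
  fix x :: "(int \<Rightarrow> 'a) \<times> int"
  obtain f l where x: "x = (f, l)" by (cases x)
  have fam: "tensor_family (\<lambda>i. delta \<one>)" by (simp add: tensor_family_def grp_alg_delta)
  show "tensor (\<lambda>i. delta \<one>) k x = delta (\<lambda>n. \<one>, k) x"
  proof (cases "x = (\<lambda>n. \<one>, k)")
    case True
    then show ?thesis using tensor_eq_prod[of "\<lambda>n. \<one>" k "{}" "\<lambda>i. delta \<one>"] by (simp add: delta_def)
  next
    case False
    have "tensor (\<lambda>i. delta \<one>) k (f, l) = 0"
    proof (rule ccontr)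
      assume "tensor (\<lambda>i. delta \<one>) k (f, l) \<noteq> 0"
      note D = tensor_nonzeroD[OF fam this]
      have "f i = \<one>" for i using D(3)[of i] by (auto simp: delta_def split: if_splits)
      then have "f = (\<lambda>n. \<one>)" by blast
      with D(1) False show False by (simp add: x)
    qed
    then show ?thesis using False by (simp add: x delta_def)
  qed
qed

lemma wr_lift_tensor:
  assumes e: "e \<in> grp_alg G"
  shows "wr_lift G e = tensor (\<lambda>i. if i = 0 then e else delta \<one>) 0"
proof
  fix x :: "(int \<Rightarrow> 'a) \<times> int"
  let ?c = "\<lambda>i::int. if i = 0 then e else delta \<one>"
  have fam: "tensor_family ?c" using e by (auto simp: tensor_family_def grp_alg_delta)
  have fin: "finite {u. e u \<noteq> 0}" "{u. e u \<noteq> 0} \<subseteq> carrier G" using e by (auto simp: grp_alg_def)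
  show "wr_lift G e x = tensor ?c 0 x"
  proof (cases "\<exists>v\<in>carrier G. x = wr_embed G v")
    case True
    then obtain v where v: "v \<in> carrier G" "x = wr_embed G v" by blast
    have inj: "wr_embed G v = wr_embed G u \<longleftrightarrow> v = u" for u
      by (auto simp: wr_embed_def fun_eq_iff)
    have "wr_lift G e x = (\<Sum>u | e u \<noteq> 0. if u = v then e u else 0)"
      unfolding wr_lift_def by (intro sum.cong) (auto simp: delta_def v inj)
    also have "\<dots> = e v" using fin by simp
    also have "\<dots> = (\<Prod>i\<in>{0}. ?c i (if i = 0 then v else \<one>))" by simp
    also have "\<dots> = tensor ?c 0 x" unfolding v(2) wr_embed_def
    proof (rule tensor_eq_prod[symmetric])
      have "{n::int. (if n = 0 then v else \<one>) \<noteq> \<one>} \<subseteq> {0}" by auto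
      then show "(\<lambda>n. if n = 0 then v else \<one>, 0) \<in> carrier (wreath_Z G)"
        using v by (auto intro: finite_subset)
    qed (auto simp: delta_def)
    finally show ?thesis .
  next
    case False
    have "wr_lift G e x = 0"
      unfolding wr_lift_def using False fin by (intro sum.neutral) (auto simp: delta_def)
    moreover have "tensor ?c 0 x = 0"
    proof (rule ccontr)
      obtain f l where x: "x = (f, l)" by (cases x)
      assume "tensor ?c 0 x \<noteq> 0"
      then have nz: "tensor ?c 0 (f, l) \<noteq> 0" by (simp add: x)
      note D = tensor_nonzeroD[OF fam nz]
      have "f i = \<one>" if "i \<noteq> 0" for i using D(3)[of i] that by (auto simp: delta_def split: if_splits)
      then have "x = wr_embed G (f 0)" using D(1) by (auto simp: x wr_embed_def fun_eq_iff)
      with False D(2) show False by auto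
    qed
    ultimately show ?thesis by simp
  qed
qed

text \<open>Conjugation by powers of \<open>t\<close> only renumbers the sites and preserves the
  trace.\<close>

lemma tensor_one_shift:
  "tensor (\<lambda>i. c (i - k)) 0 (\<lambda>n. \<one>, 0) = tensor c 0 (\<lambda>n. \<one>, 0)"
proof -
  have "(\<Prod>i | c (i - k) \<one> \<noteq> 1. c (i - k) \<one>) = (\<Prod>i | c i \<one> \<noteq> 1. c i \<one>)"
    by (rule prod.reindex_bij_witness[where i="\<lambda>i. i + k" and j="\<lambda>i. i - k"]) auto
  then show ?thesis by (simp add: tensor_def)
qed

lemma star_grp_alg:
  assumes "a \<in> grp_alg G" shows "star G a \<in> grp_alg G"
proof -
  have "{x. star G a x \<noteq> 0} \<subseteq> m_inv G ` {x. a x \<noteq> 0}"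
    using assms by (auto simp: star_def grp_alg_def image_iff split: if_splits) (metis inv_inv)
  then have "finite {x. star G a x \<noteq> 0}"
    by (rule finite_subset) (use assms in \<open>simp add: grp_alg_def\<close>)
  then show ?thesis by (auto simp: grp_alg_def star_def)
qed

text \<open>The inner product is the conjugate of the trace of adjoint times element. The equal
  powers of \<open>t\<close> cancel up to a shift of the sites, which the trace does not
  see.\<close>

lemma tensor_inner:
  assumes c: "tensor_family c" and d: "tensor_family d"
  shows "l2_inner (carrier (wreath_Z G)) (tensor c k) (tensor d k)
       = cnj (tensor (\<lambda>i. conv G (star G (c i)) (d i)) 0 (\<lambda>n. \<one>, 0))"
proof -
  have "finite {i. star G (c (i + - k)) \<noteq> delta \<one>}"
  proof (rule finite_shift, rule finite_subset)
    show "{n. star G (c n) \<noteq> delta \<one>} \<subseteq> {n. c n \<noteq> delta \<one>}" using star_delta_one by force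
  qed (use c in \<open>simp add: tensor_family_def\<close>)
  then have s: "tensor_family (\<lambda>i. star G (c (i - k)))"
    using c by (simp add: tensor_family_def star_grp_alg)
  have "l2_inner (carrier (wreath_Z G)) (tensor c k) (tensor d k)
      = cnj (conv (wreath_Z G) (star (wreath_Z G) (tensor c k)) (tensor d k) \<one>\<^bsub>wreath_Z G\<^esub>)"
    by (intro W.l2_inner_grp_alg tensor_grp_alg c d)
  also have "\<dots> = cnj (tensor (\<lambda>i. conv G (star G (c (i - k))) (d (i - k))) 0 (\<lambda>n. \<one>, 0))"
    by (simp add: tensor_star[OF c] tensor_conv[OF s d])
  also have "\<dots> = cnj (tensor (\<lambda>i. conv G (star G (c i)) (d i)) 0 (\<lambda>n. \<one>, 0))"
    by (subst tensor_one_shift[where c="\<lambda>i. conv G (star G (c i)) (d i)"]) simp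
  finally show ?thesis .
qed

end

section \<open>Discrete sine transform\<close>

text \<open>This is the Dirichlet kernel: multiplied by \<open>2 * sin (x / 2)\<close> the sum
  telescopes, and at these angles both boundary terms are multiples of
  \<open>sin (x / 2)\<close>.\<close>

lemma sum_cos_pi:
  fixes r :: int and n :: nat
  assumes "0 < \<bar>r\<bar>" "\<bar>r\<bar> < 2 * int n"
  shows "(\<Sum>m<n. cos (real m * (of_int r * pi / real n))) = (if even r then 0 else 1)"
proof -
  let ?x = "of_int r * pi / real n"
  have n: "n > 0" using assms by linarith
  have tel: "2 * sin (?x / 2) * (\<Sum>m<N. cos (real m * ?x)) = sin ((real N - 1/2) * ?x) + sin (?x / 2)" for N
  proof (induction N)
    case (Suc N)
    have "2 * sin (?x / 2) * cos (real N * ?x) = sin ((real (Suc N) - 1/2) * ?x) - sin ((real N - 1/2) * ?x)"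
      using sin_times_cos[of "?x/2" "real N * ?x"]
      by (simp add: algebra_simps sin_diff sin_add flip: minus_divide_left)
    then show ?case using Suc by (simp add: distrib_left)
  qed (simp add: mult.commute)
  \<comment> \<open>A zero would make \<open>r\<close> a multiple of \<open>2 * n\<close>, which the
    bounds on \<open>r\<close> exclude.\<close>
  have "sin (?x / 2) \<noteq> 0"
  proof
    assume "sin (?x / 2) = 0"
    then obtain k where "?x / 2 = of_int k * pi" using sin_zero_iff_int2 by auto
    then have "(of_int r :: real) = 2 * of_int k * real n" using n by (simp add: field_simps)
    then have "r = 2 * k * int n" by (metis of_int_eq_iff of_int_mult of_int_numeral of_int_of_nat_eq)
    then have "k \<noteq> 0" "\<bar>k\<bar> * int n < 1 * int n" using assms by (auto simp: abs_mult)
    then show False unfolding mult_less_cancel_right by auto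
  qed
  moreover have "sin ((real n - 1/2) * ?x) = - (if even r then 1 else -1) * sin (?x / 2)"
  proof -
    have "(real n - 1/2) * ?x = of_int r * pi - ?x / 2" using n by (simp add: field_simps)
    moreover have "sin (of_int r * pi) = 0" "cos (of_int r * pi) = (if even r then 1 else -1)"
      using sin_npi_int[of r] cos_npi_int[of r] by (simp_all add: mult.commute)
    ultimately show ?thesis by (simp add: sin_diff)
  qed
  ultimately show ?thesis using tel[of n] by (auto split: if_splits)
qed

text \<open>The product formula leads to cosine sums for \<open>j - k\<close> and
  \<open>j + k\<close>. These have equal parity, so the sums cancel unless
  \<open>j = k\<close>.\<close>

lemma sum_sin_orthogonal:
  fixes n j k :: nat
  assumes "1 \<le> j" "j < n" "1 \<le> k" "k < n"
  shows "(\<Sum>m=1..<n. sin (real m * real j * pi / real n) * sin (real m * real k * pi / real n))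
       = (if j = k then real n / 2 else 0)"
proof -
  let ?c = "\<lambda>r::int. \<Sum>m<n. cos (real m * (of_int r * pi / real n))"
  let ?s = "\<lambda>m. sin (real m * real j * pi / real n) * sin (real m * real k * pi / real n)"
  \<comment> \<open>The vanishing term \<open>m = 0\<close> is added to fit
    \<open>sum_cos_pi\<close>.\<close>
  have "(\<Sum>m=1..<n. ?s m) = (\<Sum>m<n. ?s m)"
    by (rule sum.mono_neutral_left) (auto simp: not_le)
  also have "\<dots> = (\<Sum>m<n. (cos (real m * (of_int (int j - int k) * pi / real n))
                          - cos (real m * (of_int (int j + int k) * pi / real n))) / 2)"
    by (intro sum.cong refl) (simp add: sin_times_sin algebra_simps diff_divide_distrib add_divide_distrib)
  also have "\<dots> = (?c (int j - int k) - ?c (int j + int k)) / 2"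
    by (simp add: sum_divide_distrib[symmetric] sum_subtractf)
  also have "?c (int j + int k) = (if even (int j + int k) then 0 else 1)"
    by (rule sum_cos_pi) (use assms in auto)
  also have "?c (int j - int k) = (if j = k then real n else if even (int j + int k) then 0 else 1)"
  proof (cases "j = k")
    case False
    then have "?c (int j - int k) = (if even (int j - int k) then 0 else 1)"
      by (intro sum_cos_pi) (use assms in auto)
    then show ?thesis using False by simp
  qed simp
  finally show ?thesis by (auto split: if_splits)
qed

text \<open>Pythagoras. The conditions on \<open>r\<close> make \<open>\<xi> - y i\<close>
  orthogonal to \<open>y i\<close>, as happens for \<open>\<xi> = delta \<one>\<close> and
  projections \<open>y i\<close>, whose trace is their squared norm.\<close>

lemma l2_norm_diff_orthogonal_sum:
  assumes A: "finite A" and y: "\<And>i. i \<in> A \<Longrightarrow> y i \<in> l2 X" and \<xi>: "\<xi> \<in> l2 X"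
    and orth: "\<And>i j. i \<in> A \<Longrightarrow> j \<in> A \<Longrightarrow> i \<noteq> j \<Longrightarrow> l2_inner X (y i) (y j) = 0"
    and r: "\<And>i. i \<in> A \<Longrightarrow> l2_inner X (y i) (y i) = of_real (r i)"
      "\<And>i. i \<in> A \<Longrightarrow> l2_inner X \<xi> (y i) = of_real (r i)"
  shows "(l2_norm X (\<lambda>x. \<xi> x - (\<Sum>i\<in>A. y i x)))\<^sup>2 = (l2_norm X \<xi>)\<^sup>2 - (\<Sum>i\<in>A. r i)"
proof -
  let ?S = "\<lambda>x. \<Sum>i\<in>A. y i x"
  let ?R = "of_real (\<Sum>i\<in>A. r i) :: complex"
  have S: "?S \<in> l2 X" by (rule l2_sum[OF y])
  have d: "(\<lambda>x. \<xi> x - ?S x) \<in> l2 X" by (rule l2_diff[OF \<xi> S])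
  have 1: "l2_inner X \<xi> ?S = ?R"
    by (subst l2_inner_sum_right[OF y \<xi>]) (simp_all add: r)
  have 2: "l2_inner X ?S \<xi> = ?R" by (subst l2_inner_cnj) (simp add: 1)
  have "l2_inner X (y i) ?S = of_real (r i)" if i: "i \<in> A" for i
  proof -
    have "l2_inner X (y i) ?S = (\<Sum>j\<in>A. l2_inner X (y i) (y j))"
      by (rule l2_inner_sum_right[OF y y[OF i]])
    also have "\<dots> = (\<Sum>j\<in>A. if j = i then of_real (r i) else 0)"
      by (intro sum.cong refl) (use i in \<open>auto simp: r orth\<close>)
    also have "\<dots> = of_real (r i)" using i A by simp
    finally show ?thesis .
  qed
  then have 3: "l2_inner X ?S ?S = ?R"
    by (subst l2_inner_sum_left[OF y S]) simp_all
  have "complex_of_real ((l2_norm X (\<lambda>x. \<xi> x - ?S x))\<^sup>2) = of_real ((l2_norm X \<xi>)\<^sup>2) - ?R"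
    unfolding l2_inner_self[OF d, symmetric] l2_inner_self[OF \<xi>, symmetric]
    by (simp add: l2_inner_diff_left l2_inner_diff_right \<xi> S d 1 2 3)
  then show ?thesis by (metis of_real_diff of_real_eq_iff)
qed

section \<open>Projections in the group algebra\<close>

locale group_projection = group +
  fixes e :: "'a \<Rightarrow> complex"
  assumes e_elem: "e \<in> grp_alg G" and e_sa: "star G e = e" and e_idem: "conv G e e = e"
    and e_nz: "e \<noteq> (\<lambda>x. 0)" and e_n1: "e \<noteq> delta \<one>"
begin

interpretation W: group "wreath_Z G" by (rule group_wreath_Z)

text \<open>The trace of \<open>e\<close>, that is \<open>1 / W\<close>; by \<open>e_one\<close> the
  real part loses nothing.\<close>

definition w :: real where "w = Re (e \<one>)"

definition e' :: "'a \<Rightarrow> complex" where "e' = (\<lambda>x. delta \<one> x - e x)"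

lemma e'_elem: "e' \<in> grp_alg G"
  unfolding e'_def by (intro grp_alg_diff grp_alg_delta e_elem) simp

lemma e'_sa: "star G e' = e'"
  by (simp add: e'_def star_diff star_delta_one e_sa)

lemma conv_e': "conv G e e' = (\<lambda>x. 0)" "conv G e' e = (\<lambda>x. 0)" "conv G e' e' = e'"
proof -
  show 1: "conv G e e' = (\<lambda>x. 0)"
    by (simp add: e'_def conv_diff_right conv_delta_one_right e_elem e_idem)
  show "conv G e' e = (\<lambda>x. 0)"
    unfolding e'_def
    by (subst conv_diff_left) (simp_all add: grp_alg_delta conv_delta_one_left e_elem e_idem)
  have "conv G e' e' = (\<lambda>x. conv G (delta \<one>) e' x - conv G e e' x)"
    by (subst e'_def, subst conv_diff_left) (simp_all add: grp_alg_delta e_elem)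
  then show "conv G e' e' = e'" by (simp add: 1 conv_delta_one_left e'_elem)
qed

text \<open>The trace of a projection is its squared norm. Since \<open>e\<close> and
  \<open>1 - e\<close> are both nonzero projections, \<open>w\<close> and \<open>1 - w\<close> are
  positive.\<close>

lemma e_one: "e \<one> = of_real w" and w_bounds: "0 < w" "w < 1"
proof -
  have l2: "e \<in> l2 (carrier G)" by (rule grp_alg_l2[OF e_elem])
  have "of_real ((l2_norm (carrier G) e)\<^sup>2) = l2_inner (carrier G) e e"
    by (rule l2_inner_self[OF l2, symmetric])
  also have "\<dots> = cnj (e \<one>)" by (simp add: l2_inner_grp_alg e_elem e_sa e_idem)
  finally have n: "e \<one> = of_real ((l2_norm (carrier G) e)\<^sup>2)"
    by (metis complex_cnj_cnj complex_cnj_complex_of_real)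
  then show e1: "e \<one> = of_real w" by (simp add: w_def)
  have w: "w = (l2_norm (carrier G) e)\<^sup>2" using n by (simp add: w_def)
  have "w \<noteq> 0"
    using l2_inner_self_eq_0[OF l2] l2_inner_self[OF l2] e_nz by (auto simp: w)
  then show "0 < w" using w by simp
  have l2': "e' \<in> l2 (carrier G)" by (rule grp_alg_l2[OF e'_elem])
  have "of_real ((l2_norm (carrier G) e')\<^sup>2) = l2_inner (carrier G) e' e'"
    by (rule l2_inner_self[OF l2', symmetric])
  also have "\<dots> = cnj (e' \<one>)" by (simp add: l2_inner_grp_alg e'_elem e'_sa conv_e')
  also have "\<dots> = of_real (1 - w)" by (simp add: e'_def delta_def e1)
  finally have w': "1 - w = (l2_norm (carrier G) e')\<^sup>2" by (metis of_real_eq_iff)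
  have "1 - w \<noteq> 0"
  proof
    assume "1 - w = 0"
    then have "e' = (\<lambda>x. 0)"
      using l2_inner_self_eq_0[OF l2'] l2_inner_self[OF l2'] w' by simp
    then show False using e_n1 by (auto simp: e'_def fun_eq_iff)
  qed
  then show "w < 1" using w' by (smt (verit) zero_le_power2)
qed

lemma e'_one: "e' \<one> = of_real (1 - w)"
  by (simp add: e'_def delta_def e_one)

section \<open>The operator \<open>T\<close> as a sum of two tensors\<close>

definition hop :: "(int \<Rightarrow> 'a) \<times> int \<Rightarrow> complex" where
  "hop = (\<lambda>x. conv (wreath_Z G) (wr_lift G e) (delta (wr_t G)) x
            + conv (wreath_Z G) (delta (wr_tinv G)) (wr_lift G e) x)"

definition site :: "int \<Rightarrow> int \<Rightarrow> 'a \<Rightarrow> complex" where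
  "site k = (\<lambda>i. if i = k then e else delta \<one>)"

lemma site_family: "tensor_family (site k)"
proof -
  have "{i. site k i \<noteq> delta \<one>} \<subseteq> {k}" by (auto simp: site_def)
  then show ?thesis by (auto simp: tensor_family_def site_def e_elem grp_alg_delta intro: finite_subset)
qed

lemma delta_family: "tensor_family (\<lambda>i. delta \<one>)"
  by (simp add: tensor_family_def grp_alg_delta)

text \<open>Moving \<open>t\<^sup>-\<^sup>1\<close> to the right past \<open>e\<close> shifts
  \<open>e\<close> from site 0 to site 1.\<close>

lemma hop_eq: "hop = (\<lambda>x. tensor (site 0) 1 x + tensor (site 1) (-1) x)"
proof -
  have l: "wr_lift G e = tensor (site 0) 0" by (simp add: wr_lift_tensor e_elem site_def)
  have "delta (wr_t G) = tensor (\<lambda>i. delta \<one>) 1" "delta (wr_tinv G) = tensor (\<lambda>i. delta \<one>) (-1)"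
    by (simp_all add: tensor_delta wr_t_def wr_tinv_def)
  moreover have "(\<lambda>i. conv G (site 0 i) (delta \<one>)) = site 0"
    using site_family[of 0] by (auto simp: tensor_family_def conv_delta_one_right)
  moreover have "(\<lambda>i. conv G (delta \<one>) (site 0 (i - 1))) = site 1"
    using site_family[of 0] by (auto simp: tensor_family_def conv_delta_one_left) (auto simp: site_def)
  ultimately show ?thesis
    by (simp add: hop_def l tensor_conv site_family delta_family)
qed

lemma hop_grp_alg: "hop \<in> grp_alg (wreath_Z G)"
  unfolding hop_eq by (intro W.grp_alg_add tensor_grp_alg site_family)

lemma star_site: "star G (site k i) = site k i"
  by (simp add: site_def e_sa star_delta_one)

text \<open>The adjoint exchanges the two summands.\<close>

lemma hop_sa: "star (wreath_Z G) hop = hop"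
proof -
  have "star (wreath_Z G) hop
      = (\<lambda>x. star (wreath_Z G) (tensor (site 0) 1) x + star (wreath_Z G) (tensor (site 1) (-1)) x)"
    unfolding hop_eq by (auto simp: star_def)
  moreover have "(\<lambda>i. site 0 (i - 1)) = site 1" "(\<lambda>i. site 1 (i + 1)) = site 0"
    by (auto simp: site_def)
  ultimately show ?thesis by (simp add: tensor_star site_family star_site hop_eq add.commute)
qed

text \<open>The one-site factors of \<open>p\<^sub>n\<^sub>,\<^sub>j\<close>. For
  \<open>1 \<le> j < n\<close> the range from \<open>1 - j\<close> to \<open>n - j\<close> contains
  the sites 0 and 1, where the factors \<open>e\<close> of \<open>hop\<close> sit.\<close>

definition block :: "nat \<Rightarrow> nat \<Rightarrow> int \<Rightarrow> 'a \<Rightarrow> complex" where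
  "block n j = (\<lambda>i. if i = 1 - int j \<or> i = int n - int j then e'
     else if 1 - int j < i \<and> i < int n - int j then e else delta \<one>)"

text \<open>\<open>Y n j l\<close> is \<open>p\<^sub>n\<^sub>,\<^sub>j t\<^sup>l\<close>.\<close>

definition Y :: "nat \<Rightarrow> nat \<Rightarrow> int \<Rightarrow> (int \<Rightarrow> 'a) \<times> int \<Rightarrow> complex" where
  "Y n j l = (if 1 \<le> j \<and> j < n then tensor (block n j) l else (\<lambda>x. 0))"

lemma block_family: "tensor_family (block n j)"
proof -
  \<comment> \<open>For \<open>n = 0\<close> the two ends come in reverse order, hence the minimum
    and maximum.\<close>
  have "{i. block n j i \<noteq> delta \<one>} \<subseteq> {min (1 - int j) (int n - int j)..max (1 - int j) (int n - int j)}"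
    by (auto simp: block_def split: if_splits)
  then have "finite {i. block n j i \<noteq> delta \<one>}" by (rule finite_subset) simp
  moreover have "block n j i \<in> grp_alg G" for i by (simp add: block_def e_elem e'_elem grp_alg_delta)
  ultimately show ?thesis by (simp add: tensor_family_def)
qed

lemma Y_grp_alg: "Y n j l \<in> grp_alg (wreath_Z G)"
  unfolding Y_def using tensor_grp_alg[OF block_family] by (auto simp: grp_alg_def)

lemma Y_l2: "Y n j l \<in> l2 (carrier (wreath_Z G))"
  by (rule W.grp_alg_l2[OF Y_grp_alg])

text \<open>Multiplication by \<open>t\<close> or its inverse shifts the block by one site. If the
  factor \<open>e\<close> of \<open>hop\<close> then meets an interior site it is absorbed; at an
  end of the path it meets \<open>1 - e\<close> and the product vanishes, in accordance with
  \<open>Y\<close> being zero at the indices 0 and \<open>n\<close>.\<close>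

lemma hop_Y:
  assumes j: "1 \<le> j" "j < n"
  shows "conv (wreath_Z G) hop (Y n j l) = (\<lambda>x. Y n (j + 1) (l + 1) x + Y n (j - 1) (l - 1) x)"
proof -
  have blk: "block n j i \<in> grp_alg G" for i using block_family[of n j] by (simp add: tensor_family_def)
  have c: "conv (wreath_Z G) hop (Y n j l)
     = (\<lambda>x. tensor (\<lambda>i. conv G (site 0 i) (block n j (i + 1))) (1 + l) x
          + tensor (\<lambda>i. conv G (site 1 i) (block n j (i - 1))) (- 1 + l) x)"
    unfolding hop_eq using j
    by (simp add: Y_def W.conv_add_left tensor_grp_alg site_family tensor_conv block_family)
  have fam: "tensor_family (\<lambda>i. conv G (site k i) (block n j (i + m)))" for k m
  proof -
    have "finite {i. block n j (i + m) \<noteq> delta \<one>}"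
      using block_family[of n j] by (intro finite_shift) (simp add: tensor_family_def)
    then have fin: "finite ({k} \<union> {i. block n j (i + m) \<noteq> delta \<one>})" by simp
    have "finite {i. conv G (site k i) (block n j (i + m)) \<noteq> delta \<one>}"
      by (rule finite_subset[OF _ fin]) (auto simp: site_def conv_delta_one_left grp_alg_delta)
    moreover have "conv G (site k i) (block n j (i + m)) \<in> grp_alg G" for i
      using blk[of "i + m"] e_elem e'_elem
      by (auto simp: site_def conv_delta_one_left block_def e_idem conv_e' conv_delta_one_right)
        (auto simp: grp_alg_def)
    ultimately show ?thesis by (simp add: tensor_family_def)
  qed
  have "tensor (\<lambda>i. conv G (site 0 i) (block n j (i + 1))) (1 + l) = Y n (j + 1) (l + 1)"
  proof (cases "j + 1 < n")
    case True
    have "conv G (site 0 i) (block n j (i + 1)) = block n (j + 1) i" for i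
      using True j e_elem e'_elem grp_alg_delta[of \<one>]
      by (auto simp: site_def conv_delta_one_left block_def e_idem)
    then show ?thesis using True by (simp add: Y_def add.commute)
  next
    case False
    \<comment> \<open>Here \<open>j + 1 = n\<close>, so the shift has moved the right end of the
      block to site 0.\<close>
    then have "conv G (site 0 0) (block n j (0 + 1)) = (\<lambda>x. 0)"
      using j by (simp add: site_def block_def conv_e')
    from tensor_zero[OF fam, OF this] show ?thesis using False by (simp add: Y_def)
  qed
  moreover have "tensor (\<lambda>i. conv G (site 1 i) (block n j (i - 1))) (- 1 + l) = Y n (j - 1) (l - 1)"
  proof (cases "1 \<le> j - 1")
    case True
    have "conv G (site 1 i) (block n j (i - 1)) = block n (j - 1) i" for i
      using True j e_elem e'_elem grp_alg_delta[of \<one>]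
      by (auto simp: site_def conv_delta_one_left block_def e_idem of_nat_diff)
    moreover have "j - 1 < n" using j by simp
    ultimately show ?thesis using True by (simp add: Y_def)
  next
    case False
    then have "j = 1" using j by simp
    \<comment> \<open>For \<open>j = 1\<close> the shift has moved the left end of the block to site
      1.\<close>
    then have "conv G (site 1 1) (block n j (1 + -1)) = (\<lambda>x. 0)"
      by (simp add: site_def block_def conv_e')
    from tensor_zero[OF fam, OF this] show ?thesis using False by (simp add: Y_def)
  qed
  ultimately show ?thesis by (simp add: c)
qed

text \<open>The trace of each \<open>p\<^sub>n\<^sub>,\<^sub>j\<close>: two ends and
  \<open>n - 2\<close> sites between them.\<close>

definition block_trace :: "nat \<Rightarrow> real" where
  "block_trace n = w ^ (n - 2) * (1 - w)\<^sup>2"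

lemma Y_one:
  assumes "1 \<le> j" "j < n"
  shows "Y n j l (\<lambda>n. \<one>, 0) = (if l = 0 then of_real (block_trace n) else 0)"
proof (cases "l = 0")
  case True
  let ?a = "1 - int j" and ?b = "int n - int j"
  have ab: "?a < ?b" using assms by simp
  have I: "{?a..?b} = insert ?a (insert ?b {?a<..<?b})" using ab by auto
  have "tensor (block n j) 0 (\<lambda>n. \<one>, 0) = (\<Prod>i\<in>{?a..?b}. block n j i \<one>)"
    by (rule tensor_eq_prod) (use ab in \<open>auto simp: block_def delta_def\<close>)
  also have "\<dots> = block n j ?a \<one> * (block n j ?b \<one> * (\<Prod>i\<in>{?a<..<?b}. block n j i \<one>))"
    unfolding I using ab by simp
  also have "(\<Prod>i\<in>{?a<..<?b}. block n j i \<one>) = (\<Prod>i\<in>{?a<..<?b}. e \<one>)"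
    by (intro prod.cong) (auto simp: block_def)
  also have "\<dots> = of_real w ^ (n - 2)"
  proof -
    have "nat (?b - (?a + 1)) = n - 2" using assms by simp
    then show ?thesis by (simp add: e_one)
  qed
  finally show ?thesis
    using assms True by (simp add: Y_def block_trace_def block_def e'_one power2_eq_square)
qed (use assms in \<open>simp add: Y_def tensor_other\<close>)

text \<open>The factors are self-adjoint idempotents, so the squared norm is the trace; the powers
  of \<open>t\<close> cancel.\<close>

lemma Y_inner_self:
  assumes "1 \<le> j" "j < n"
  shows "l2_inner (carrier (wreath_Z G)) (Y n j l) (Y n j l) = of_real (block_trace n)"
proof -
  have "conv G (star G (block n j i)) (block n j i) = block n j i" for i
    by (simp add: block_def e'_sa e_sa star_delta_one conv_e' e_idem conv_delta_one_left grp_alg_delta)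
  then show ?thesis using assms Y_one[OF assms, of 0]
    by (simp add: Y_def tensor_inner block_family del: wreath_Z_simps)
qed

text \<open>At some site one block has \<open>1 - e\<close> and the other has \<open>e\<close>: at
  the left end nearer to the origin if the left ends differ, otherwise at the right end of the
  shorter block.\<close>

lemma Y_orthogonal:
  assumes j: "1 \<le> j" "j < n" and k: "1 \<le> k" "k < m" and ne: "(n, j) \<noteq> (m, k)"
  shows "l2_inner (carrier (wreath_Z G)) (Y n j l) (Y m k l) = 0"
proof -
  have star: "star G (block n j i) = block n j i" for i
    by (simp add: block_def e'_sa e_sa star_delta_one)
  have mul: "conv G (block n j i) (block m k i) \<in> {delta \<one>, e, e', (\<lambda>x. 0)}" for i
    by (simp add: block_def conv_e' e_idem conv_delta_one_left conv_delta_one_right grp_alg_delta e_elem e'_elem)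
  have fin: "finite ({i. block n j i \<noteq> delta \<one>} \<union> {i. block m k i \<noteq> delta \<one>})"
    using block_family[of n j] block_family[of m k] by (simp add: tensor_family_def)
  have "finite {i. conv G (block n j i) (block m k i) \<noteq> delta \<one>}"
    by (rule finite_subset[OF _ fin]) (auto simp: conv_delta_one_left grp_alg_delta)
  moreover have "conv G (block n j i) (block m k i) \<in> grp_alg G" for i
    using mul[of i] e_elem e'_elem grp_alg_delta[of \<one>] by (auto simp: grp_alg_def)
  ultimately have fam: "tensor_family (\<lambda>i. conv G (block n j i) (block m k i))"
    by (simp add: tensor_family_def)
  have "\<exists>i. conv G (block n j i) (block m k i) = (\<lambda>x. 0)"
  proof -
    consider "j < k" | "k < j" | "j = k" "n < m" | "j = k" "m < n" using ne by force
    then show ?thesis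
    proof cases
      case 1
      then show ?thesis using j k by (intro exI[of _ "1 - int j"]) (simp add: block_def conv_e')
    next
      case 2
      then show ?thesis using j k by (intro exI[of _ "1 - int k"]) (simp add: block_def conv_e')
    next
      case 3
      then show ?thesis using j k by (intro exI[of _ "int n - int j"]) (simp add: block_def conv_e')
    next
      case 4
      then show ?thesis using j k by (intro exI[of _ "int m - int j"]) (simp add: block_def conv_e')
    qed
  qed
  then obtain i where i: "conv G (block n j i) (block m k i) = (\<lambda>x. 0)" by blast
  have "tensor (\<lambda>i. conv G (block n j i) (block m k i)) 0 = (\<lambda>x. 0)"
    using tensor_zero[OF fam i] .
  then show ?thesis using j k by (simp add: Y_def tensor_inner block_family star del: wreath_Z_simps)
qed

end

section \<open>Eigenvalues of finite paths\<close>

text \<open>The indices of those eigenvalues of the path with \<open>n - 1\<close> vertices that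
  equal \<open>\<mu>\<close>.\<close>

definition path_modes :: "real \<Rightarrow> nat \<Rightarrow> nat set" where
  "path_modes \<mu> n = {m \<in> {1..<n}. 2 * cos (real m * pi / real n) = \<mu>}"

text \<open>Both angles lie between 0 and \<pi>, where the cosine is injective.\<close>

lemma cos_fraction_inj:
  assumes "2 * cos (real m * pi / real n) = 2 * cos (real p * pi / real q)" "m < n" "p < q"
  shows "m * q = p * n"
proof -
  have le: "real i * pi / real l \<le> pi" if "i < l" for i l
    using that by (simp add: pos_divide_le_eq mult.commute)
  have "real m * pi / real n = real p * pi / real q"
  proof (rule cos_inj_pi)
    show "cos (real m * pi / real n) = cos (real p * pi / real q)" using assms(1) by simp
  qed (use le[OF assms(2)] le[OF assms(3)] in simp_all)
  then have "pi * (real m * real q) = pi * (real p * real n)"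
    using assms by (simp add: frac_eq_eq mult_ac)
  then have "real (m * q) = real (p * n)" by simp
  then show ?thesis by (simp only: of_nat_eq_iff)
qed

text \<open>The eigenvalues of a path are simple.\<close>

lemma card_path_modes_le: "card (path_modes \<mu> n) \<le> 1"
proof -
  have "a = b" if "a \<in> path_modes \<mu> n" "b \<in> path_modes \<mu> n" for a b
    using that cos_fraction_inj[of a n b n] by (auto simp: path_modes_def)
  then show ?thesis by (intro card_le_Suc0_iff_eq[THEN iffD2, simplified One_nat_def[symmetric]])
      (auto simp: path_modes_def)
qed

lemma path_modes_empty:
  assumes "\<mu> \<notin> (\<Union>n\<in>{2..}. M_set n)" shows "path_modes \<mu> n = {}"
proof (rule equals0I)
  fix m assume m: "m \<in> path_modes \<mu> n"
  then have mn: "1 \<le> m" "m < n" "\<mu> = 2 * cos (real m * pi / real n)" by (auto simp: path_modes_def)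
  \<comment> \<open>Cancelling \<open>g\<close> puts \<open>m / n\<close> in lowest terms; the new
    denominator is still at least 2.\<close>
  define g where "g = gcd m n"
  have g: "g > 0" "m = g * (m div g)" "n = g * (n div g)" using mn by (auto simp: g_def)
  have cop: "coprime (m div g) (n div g)" unfolding g_def using mn by (intro div_gcd_coprime) auto
  have pos: "m div g \<ge> 1" using g mn by (metis less_one mult_0_right not_less)
  have lt: "m div g < n div g" using g mn by (metis nat_mult_less_cancel_disj)
  have "real m / real n = real (m div g) / real (n div g)"
    using g by (metis (no_types, lifting) mult_divide_mult_cancel_left of_nat_0_less_iff of_nat_mult order_less_irrefl)
  then have "\<mu> = 2 * cos (real (m div g) / real (n div g) * pi)" using mn by (metis times_divide_eq_left)
  then have "\<mu> \<in> M_set (n div g)" using cop pos lt by (auto simp: M_set_def intro!: exI[of _ "m div g"])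
  moreover have "n div g \<ge> 2" using pos lt by linarith
  ultimately show False using assms by auto
qed

text \<open>A fraction \<open>p / q\<close> in lowest terms can be written with positive denominator
  \<open>n\<close> exactly when \<open>q\<close> divides \<open>n\<close>. The value
  \<open>n = 0\<close> is divisible by \<open>q\<close> but has no modes.\<close>

lemma card_path_modes:
  assumes "\<mu> \<in> M_set q" "q \<ge> 2"
  shows "card (path_modes \<mu> n) = (if q dvd n \<and> n \<noteq> 0 then 1 else 0)"
proof -
  obtain p where p: "1 \<le> p" "p \<le> q - 1" "coprime p q" "\<mu> = 2 * cos (real p / real q * pi)"
    using assms by (auto simp: M_set_def)
  have pq: "p < q" using p assms by simp
  show ?thesis
  proof (cases "q dvd n \<and> n \<noteq> 0")
    case True
    then obtain t where t: "n = q * t" "t \<noteq> 0" by auto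
    have "p * t \<in> path_modes \<mu> n"
      using p pq t by (auto simp: path_modes_def)
    then have "card (path_modes \<mu> n) > 0" by (auto simp: card_gt_0_iff path_modes_def)
    then show ?thesis using True card_path_modes_le[of \<mu> n] by simp
  next
    case False
    have "path_modes \<mu> n = {}"
    proof (rule equals0I)
      fix m assume "m \<in> path_modes \<mu> n"
      then have m: "1 \<le> m" "m < n" "m * q = p * n"
        using p pq cos_fraction_inj[of m n p q] by (auto simp: path_modes_def)
      have "q dvd p * n" using m(3) by (metis dvd_triv_right)
      then have "q dvd n" using p(3) by (simp add: coprime_commute coprime_dvd_mult_right_iff)
      then show False using False m by simp
    qed
    then show ?thesis using False by simp
  qed
qed

section \<open>Spectral decomposition\<close>

context group_projection
begin

interpretation W: group "wreath_Z G" by (rule group_wreath_Z)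

abbreviation X where "X \<equiv> carrier (wreath_Z G)"

text \<open>The sine eigenvector along one path. The power \<open>j - k\<close> of \<open>t\<close>
  changes in step with \<open>j\<close>, as \<open>hop_Y\<close> requires, and is 0 at
  \<open>j = k\<close>, so this path passes through \<open>p\<^sub>n\<^sub>,\<^sub>k\<close>
  itself.\<close>

definition mode :: "nat \<Rightarrow> nat \<Rightarrow> nat \<Rightarrow> (int \<Rightarrow> 'a) \<times> int \<Rightarrow> complex" where
  "mode n m k = (\<lambda>x. \<Sum>j=1..<n. of_real (sin (real m * real j * pi / real n)) * Y n j (int j - int k) x)"

lemma mode_eigsp: "mode n m k \<in> eigsp (wreath_Z G) hop (2 * cos (real m * pi / real n))"
proof (cases "n \<ge> 2")
  case True
  let ?s = "\<lambda>j. complex_of_real (sin (real m * real j * pi / real n))"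
  let ?c = "complex_of_real (2 * cos (real m * pi / real n))"
  let ?y = "\<lambda>j x. Y n j (int j - int k) x"
  have l2: "mode n m k \<in> l2 X" unfolding mode_def by (intro l2_sum l2_scale Y_l2)
  have "conv (wreath_Z G) hop (mode n m k) x = ?c * mode n m k x" for x
  proof -
    have y0: "?y 0 x = 0" and yn: "?y n x = 0" by (simp_all add: Y_def)
    have s0: "?s 0 = 0" by simp
    have sn: "?s n = 0" using True by (simp add: sin_npi)
    \<comment> \<open>The addition theorem for the sine is the eigenvector equation at vertex
      \<open>j\<close>.\<close>
    have rec: "?s (j + 1) + ?s (j - 1) = ?c * ?s j" if "1 \<le> j" for j
    proof -
      have 1: "real m * real (j + 1) * pi / real n = real m * real j * pi / real n + real m * pi / real n"
        by (simp add: algebra_simps add_divide_distrib)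
      have 2: "real m * real (j - 1) * pi / real n = real m * real j * pi / real n - real m * pi / real n"
        using that by (simp add: of_nat_diff algebra_simps diff_divide_distrib)
      show ?thesis
        unfolding of_real_add[symmetric] of_real_mult[symmetric] of_real_eq_iff 1 2 sin_add sin_diff
        by (simp add: algebra_simps)
    qed
    have "conv (wreath_Z G) hop (mode n m k) x
        = (\<Sum>j=1..<n. ?s j * conv (wreath_Z G) hop (Y n j (int j - int k)) x)"
      unfolding mode_def by (simp add: W.conv_sum_right W.conv_scale_right)
    also have "\<dots> = (\<Sum>j=1..<n. ?s j * ?y (j + 1) x + ?s j * ?y (j - 1) x)"
    proof (intro sum.cong refl)
      fix j assume j: "j \<in> {1..<n}"
      have eq: "int (j + 1) - int k = int j - int k + 1" "int (j - 1) - int k = int j - int k - 1"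
        using j by (auto simp: of_nat_diff)
      show "?s j * conv (wreath_Z G) hop (Y n j (int j - int k)) x = ?s j * ?y (j + 1) x + ?s j * ?y (j - 1) x"
        unfolding eq using j by (subst hop_Y) (auto simp: distrib_left)
    qed
    also have "\<dots> = (\<Sum>j=1..<n. ?s j * ?y (j + 1) x) + (\<Sum>j=1..<n. ?s j * ?y (j - 1) x)"
      by (rule sum.distrib)
    also have "(\<Sum>j=1..<n. ?s j * ?y (j + 1) x) = (\<Sum>j=1..<n. ?s (j - 1) * ?y j x)"
    proof -
      \<comment> \<open>The term \<open>j = 0\<close> enters freely because \<open>?s 0 = 0\<close>;
        after the shift the term \<open>j = n\<close> drops out because
        \<open>?y n x = 0\<close>.\<close>
      have "(\<Sum>j=1..<n. ?s j * ?y (j + 1) x) = (\<Sum>j=0..<n. ?s j * ?y (j + 1) x)"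
        using True by (subst (2) sum.atLeast_Suc_lessThan) auto
      also have "\<dots> = (\<Sum>j=Suc 0..<Suc n. ?s (j - 1) * ?y j x)"
        by (subst sum.shift_bounds_Suc_ivl) simp
      also have "\<dots> = (\<Sum>j=1..<n. ?s (j - 1) * ?y j x)"
        using True yn by simp
      finally show ?thesis .
    qed
    also have "(\<Sum>j=1..<n. ?s j * ?y (j - 1) x) = (\<Sum>j=1..<n. ?s (j + 1) * ?y j x)"
    proof -
      \<comment> \<open>Now \<open>j = n\<close> enters freely because \<open>?s n = 0\<close>, and
        \<open>j = 0\<close> drops out after the shift because \<open>?y 0 x = 0\<close>.\<close>
      have "(\<Sum>j=1..<n. ?s j * ?y (j - 1) x) = (\<Sum>j=Suc 0..<Suc n. ?s j * ?y (j - 1) x)"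
        using True sn by simp
      also have "\<dots> = (\<Sum>j=0..<n. ?s (j + 1) * ?y j x)"
        by (subst sum.shift_bounds_Suc_ivl) simp
      also have "\<dots> = (\<Sum>j=1..<n. ?s (j + 1) * ?y j x)"
        using True y0 by (subst sum.atLeast_Suc_lessThan) auto
      finally show ?thesis .
    qed
    also have "(\<Sum>j=1..<n. ?s (j - 1) * ?y j x) + (\<Sum>j=1..<n. ?s (j + 1) * ?y j x)
        = (\<Sum>j=1..<n. (?s (j + 1) + ?s (j - 1)) * ?y j x)"
      by (simp add: sum.distrib distrib_right add.commute)
    also have "\<dots> = (\<Sum>j=1..<n. ?c * (?s j * ?y j x))"
      by (intro sum.cong refl) (subst rec, auto)
    also have "\<dots> = ?c * mode n m k x"
      unfolding mode_def by (simp add: sum_distrib_left)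
    finally show ?thesis .
  qed
  then show ?thesis using l2 by (auto simp: eigsp_def)
next
  case False
  then have "mode n m k = (\<lambda>x. 0)" by (auto simp: mode_def)
  then show ?thesis by (simp add: W.eigsp_zero)
qed

text \<open>By sine inversion \<open>p\<^sub>n\<^sub>,\<^sub>k\<close> is the sum over
  \<open>m\<close> of these multiples of \<open>mode n m k\<close>. Collected over \<open>k\<close>,
  they form the component of the sum of all \<open>p\<^sub>n\<^sub>,\<^sub>k\<close> belonging to
  the eigenvalue \<open>2 cos (m \<pi> / n)\<close>.\<close>

definition mode_part :: "nat \<Rightarrow> nat \<Rightarrow> (int \<Rightarrow> 'a) \<times> int \<Rightarrow> complex" where
  "mode_part n m = (\<lambda>x. \<Sum>k=1..<n. of_real (2 / real n * sin (real m * real k * pi / real n)) * mode n m k x)"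

lemma mode_part_eigsp: "mode_part n m \<in> eigsp (wreath_Z G) hop (2 * cos (real m * pi / real n))"
  unfolding mode_part_def by (intro W.eigsp_sum W.eigsp_scale mode_eigsp)

lemma mode_part_l2: "mode_part n m \<in> l2 X"
  by (rule W.eigspD(1)[OF mode_part_eigsp])

text \<open>Summing over \<open>m\<close> first, sine orthogonality leaves only
  \<open>j = k\<close>, where the power of \<open>t\<close> is 0.\<close>

lemma sum_mode_part: "(\<Sum>m=1..<n. mode_part n m x) = (\<Sum>k=1..<n. Y n k 0 x)"
proof -
  let ?s = "\<lambda>m j. sin (real m * real j * pi / real n)"
  have "(\<Sum>m=1..<n. mode_part n m x)
     = (\<Sum>m=1..<n. \<Sum>k=1..<n. \<Sum>j=1..<n. of_real (2 / real n * (?s m k * ?s m j)) * Y n j (int j - int k) x)"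
    unfolding mode_part_def mode_def by (simp add: sum_distrib_left mult_ac)
  also have "\<dots> = (\<Sum>k=1..<n. \<Sum>m=1..<n. \<Sum>j=1..<n. of_real (2 / real n * (?s m k * ?s m j)) * Y n j (int j - int k) x)"
    by (rule sum.swap)
  also have "\<dots> = (\<Sum>k=1..<n. \<Sum>j=1..<n. \<Sum>m=1..<n. of_real (2 / real n * (?s m k * ?s m j)) * Y n j (int j - int k) x)"
    by (intro sum.cong refl sum.swap)
  also have "\<dots> = (\<Sum>k=1..<n. \<Sum>j=1..<n. of_real (2 / real n * (\<Sum>m=1..<n. ?s m k * ?s m j)) * Y n j (int j - int k) x)"
    by (simp add: sum_distrib_left sum_distrib_right)
  also have "\<dots> = (\<Sum>k=1..<n. \<Sum>j=1..<n. if j = k then Y n j (int j - int k) x else 0)"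
  proof (intro sum.cong refl)
    fix k j assume kj: "k \<in> {1..<n}" "j \<in> {1..<n}"
    then have "(\<Sum>m=1..<n. ?s m k * ?s m j) = (if k = j then real n / 2 else 0)"
      by (intro sum_sin_orthogonal) auto
    then show "of_real (2 / real n * (\<Sum>m=1..<n. ?s m k * ?s m j)) * Y n j (int j - int k) x
        = (if j = k then Y n j (int j - int k) x else 0)"
      using kj by auto
  qed
  also have "\<dots> = (\<Sum>k=1..<n. Y n k 0 x)" by simp
  finally show ?thesis .
qed

text \<open>Only terms without a power of \<open>t\<close>, that is \<open>j = k\<close>, have a
  trace; their squared sines sum to \<open>n / 2\<close> and cancel the normalisation.\<close>

lemma mode_part_one:
  assumes m: "1 \<le> m" "m < n"
  shows "mode_part n m (\<lambda>n. \<one>, 0) = of_real (block_trace n)"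
proof -
  let ?s = "\<lambda>k. sin (real m * real k * pi / real n)"
  have "mode n m k (\<lambda>n. \<one>, 0) = of_real (?s k * block_trace n)" if "k \<in> {1..<n}" for k
  proof -
    have "mode n m k (\<lambda>n. \<one>, 0) = (\<Sum>j=1..<n. if j = k then of_real (?s k * block_trace n) else 0)"
      unfolding mode_def by (intro sum.cong refl) (auto simp: Y_one)
    then show ?thesis using that by simp
  qed
  then have "mode_part n m (\<lambda>n. \<one>, 0)
      = (\<Sum>k=1..<n. of_real (2 / real n * ?s k) * of_real (?s k * block_trace n))"
    unfolding mode_part_def by simp
  also have "\<dots> = of_real (2 / real n * block_trace n * (\<Sum>k=1..<n. ?s k * ?s k))"
    by (simp add: sum_distrib_left mult_ac)
  also have "(\<Sum>k=1..<n. ?s k * ?s k) = real n / 2"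
    using sum_sin_orthogonal[of m n m] m by (simp add: mult_ac)
  finally show ?thesis using m by simp
qed

section \<open>Norm bounds and summability\<close>

lemma Y_norm_le: "l2_norm X (Y n j l) \<le> sqrt w ^ (n - 2)"
proof (cases "1 \<le> j \<and> j < n")
  case True
  have "complex_of_real ((l2_norm X (Y n j l))\<^sup>2) = of_real (block_trace n)"
    using True by (simp only: l2_inner_self[OF Y_l2, symmetric] Y_inner_self)
  then have "(l2_norm X (Y n j l))\<^sup>2 = block_trace n" by (simp only: of_real_eq_iff)
  also have "\<dots> \<le> w ^ (n - 2) * 1"
    unfolding block_trace_def using w_bounds by (intro mult_left_mono power_le_one) auto
  also have "\<dots> = (sqrt w ^ (n - 2))\<^sup>2"
    using w_bounds by (simp flip: power_mult add: mult.commute) (simp add: power_mult)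
  finally show ?thesis by (rule power2_le_imp_le) (use w_bounds in simp)
qed (use w_bounds in \<open>auto simp: Y_def\<close>)

text \<open>A crude estimate with all sines bounded by 1; the geometric factor is what makes the
  bounds summable.\<close>

lemma mode_part_norm_le: "l2_norm X (mode_part n m) \<le> 2 * real n * sqrt w ^ (n - 2)"
proof (cases "n = 0")
  case False
  have mode: "l2_norm X (mode n m k) \<le> real n * sqrt w ^ (n - 2)" for k
  proof -
    have "l2_norm X (mode n m k) \<le> (\<Sum>j=1..<n. 1 * sqrt w ^ (n - 2))"
      unfolding mode_def
    proof (rule order_trans[OF l2_norm_sum_le[OF l2_scale[OF Y_l2]] sum_mono])
      fix j
      show "l2_norm X (\<lambda>x. of_real (sin (real m * real j * pi / real n)) * Y n j (int j - int k) x)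
          \<le> 1 * sqrt w ^ (n - 2)"
        unfolding l2_norm_scale by (intro mult_mono Y_norm_le) auto
    qed
    also have "\<dots> \<le> real n * sqrt w ^ (n - 2)" using w_bounds by (simp add: mult_right_mono)
    finally show ?thesis .
  qed
  have "l2_norm X (mode_part n m) \<le> (\<Sum>k=1..<n. 2 / real n * (real n * sqrt w ^ (n - 2)))"
    unfolding mode_part_def
  proof (rule order_trans[OF l2_norm_sum_le[OF l2_scale[OF W.eigspD(1)[OF mode_eigsp]]] sum_mono])
    fix k
    have "\<bar>2 / real n * sin (real m * real k * pi / real n)\<bar> \<le> 2 / real n * 1"
      unfolding abs_mult by (intro mult_mono) auto
    then show "l2_norm X (\<lambda>x. of_real (2 / real n * sin (real m * real k * pi / real n)) * mode n m k x)
        \<le> 2 / real n * (real n * sqrt w ^ (n - 2))"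
      unfolding l2_norm_scale norm_of_real using mode by (intro mult_mono) auto
  qed
  also have "\<dots> = real (n - 1) * (2 * sqrt w ^ (n - 2))" using False by simp
  also have "\<dots> \<le> real n * (2 * sqrt w ^ (n - 2))" using w_bounds by (intro mult_right_mono) auto
  finally show ?thesis by simp
qed (simp add: mode_part_def)

text \<open>By the derivative of the geometric series, the traces of all
  \<open>p\<^sub>n\<^sub>,\<^sub>j\<close> together exhaust the trace of 1.\<close>

lemma block_trace_sums: "(\<lambda>n. real (n - 1) * block_trace n) sums 1"
proof -
  have "(\<lambda>i. (1 - w)\<^sup>2 * (real (Suc i) * w ^ i)) sums ((1 - w)\<^sup>2 * (1 / (1 - w)\<^sup>2))"
    using w_bounds by (intro sums_mult geometric_deriv_sums) auto
  then have "(\<lambda>i. real (i + 2 - 1) * block_trace (i + 2)) sums 1"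
    using w_bounds by (simp add: block_trace_def mult_ac)
  \<comment> \<open>The terms with \<open>n < 2\<close> vanish because \<open>n - 1\<close> is
    truncated to 0.\<close>
  then show ?thesis
    by (subst (asm) sums_zero_iff_shift[of 2]) (auto simp: less_2_cases_iff)
qed

lemma summable_mode_bound: "summable (\<lambda>n. 2 * real n * sqrt w ^ (n - 2))"
proof -
  have s: "norm (sqrt w) < 1" using w_bounds by simp
  have "summable (\<lambda>i. 2 * (real (Suc i) * sqrt w ^ i + sqrt w ^ i))"
    using geometric_deriv_sums[OF s] summable_geometric[OF s]
    by (intro summable_mult summable_add) (auto simp: sums_iff)
  then have "summable (\<lambda>i. 2 * real (i + 2) * sqrt w ^ (i + 2 - 2))"
    by (simp add: algebra_simps)
  then show ?thesis by (simp only: summable_iff_shift[of "\<lambda>n. 2 * real n * sqrt w ^ (n - 2)" 2])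
qed

section \<open>Approximation of \<open>unit\<close> by eigenvectors\<close>

abbreviation unit :: "(int \<Rightarrow> 'a) \<times> int \<Rightarrow> complex" where
  "unit \<equiv> delta (\<lambda>n. \<one>, 0)"

lemma unit_l2: "unit \<in> l2 X"
  by (rule l2_delta) simp

definition blocks :: "nat \<Rightarrow> (int \<Rightarrow> 'a) \<times> int \<Rightarrow> complex" where
  "blocks B = (\<lambda>x. \<Sum>n<B. \<Sum>k=1..<n. Y n k 0 x)"

lemma blocks_modes: "blocks B x = (\<Sum>n<B. \<Sum>m=1..<n. mode_part n m x)"
  by (simp only: blocks_def sum_mode_part)

lemma blocks_eigspan: "blocks B \<in> W.eigspan hop"
  unfolding blocks_modes[abs_def] by (intro W.eigspan_sum W.eigspan_eigsp[OF mode_part_eigsp])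

text \<open>By Pythagoras the squared error is 1 minus the traces collected so far, and
  \<open>block_trace_sums\<close> leaves nothing over.\<close>

lemma blocks_tendsto: "(\<lambda>B. l2_norm X (\<lambda>x. unit x - blocks B x)) \<longlonglongrightarrow> 0"
proof -
  have sq: "(l2_norm X (\<lambda>x. unit x - blocks B x))\<^sup>2 = 1 - (\<Sum>n<B. real (n - 1) * block_trace n)" for B
  proof -
    let ?A = "SIGMA n:{..<B}. {1..<n}"
    let ?y = "\<lambda>(n, k). Y n k 0"
    have "(l2_norm X (\<lambda>x. unit x - (\<Sum>i\<in>?A. ?y i x)))\<^sup>2
        = (l2_norm X unit)\<^sup>2 - (\<Sum>i\<in>?A. block_trace (fst i))"
    proof (rule l2_norm_diff_orthogonal_sum)
      fix i assume i: "i \<in> ?A"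
      show "l2_inner X (?y i) (?y i) = of_real (block_trace (fst i))"
        using i Y_inner_self by (auto simp del: wreath_Z_simps)
      have "l2_inner X unit (?y i) = cnj (?y i (\<lambda>n. \<one>, 0))"
        by (subst l2_inner_cnj, subst l2_inner_delta) simp_all
      then show "l2_inner X unit (?y i) = of_real (block_trace (fst i))"
        using i Y_one by (auto simp del: wreath_Z_simps)
    next
      fix i j assume "i \<in> ?A" "j \<in> ?A" "i \<noteq> j"
      then show "l2_inner X (?y i) (?y j) = 0"
        using Y_orthogonal by (cases i, cases j) (auto simp del: wreath_Z_simps)
    qed (use Y_l2 unit_l2 in \<open>auto simp del: wreath_Z_simps\<close>)
    moreover have "(\<Sum>i\<in>?A. ?y i x) = blocks B x" for x
      unfolding blocks_def by (subst sum.Sigma) (auto intro!: sum.cong)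
    moreover have "(\<Sum>i\<in>?A. block_trace (fst i)) = (\<Sum>n<B. real (n - 1) * block_trace n)"
    proof -
      have "(\<Sum>i\<in>?A. block_trace (fst i)) = (\<Sum>n<B. \<Sum>k\<in>{1..<n}. block_trace n)"
        by (subst sum.Sigma) (auto intro!: sum.cong)
      then show ?thesis by simp
    qed
    moreover have "(l2_norm X unit)\<^sup>2 = 1"
    proof -
      have "complex_of_real ((l2_norm X unit)\<^sup>2) = l2_inner X unit unit"
        by (rule l2_inner_self[OF unit_l2, symmetric])
      also have "\<dots> = 1" by (subst l2_inner_delta) (simp_all add: delta_def)
      finally show ?thesis by (metis of_real_1 of_real_eq_iff)
    qed
    ultimately show ?thesis by simp
  qed
  have "(\<lambda>B. 1 - (\<Sum>n<B. real (n - 1) * block_trace n)) \<longlonglongrightarrow> 1 - 1"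
    using block_trace_sums unfolding sums_def by (intro tendsto_intros)
  then have "(\<lambda>B. sqrt ((l2_norm X (\<lambda>x. unit x - blocks B x))\<^sup>2)) \<longlonglongrightarrow> sqrt 0"
    unfolding sq by (intro tendsto_real_sqrt) simp
  then show ?thesis by simp
qed

lemma eigspan_hop_dense:
  assumes "\<xi> \<in> l2 X" "\<epsilon> > 0"
  shows "\<exists>\<zeta>\<in>W.eigspan hop. l2_norm X (\<lambda>x. \<xi> x - \<zeta> x) < \<epsilon>"
proof (rule W.eigspan_dense[OF hop_grp_alg _ assms])
  fix \<epsilon> :: real assume "\<epsilon> > 0"
  then obtain B where "norm (l2_norm X (\<lambda>x. unit x - blocks B x) - 0) < \<epsilon>"
    using LIMSEQ_D[OF blocks_tendsto] by blast
  then show "\<exists>\<zeta>\<in>W.eigspan hop. l2_norm X (\<lambda>x. delta \<one>\<^bsub>wreath_Z G\<^esub> x - \<zeta> x) < \<epsilon>"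
    using blocks_eigspan[of B] by (intro bexI[of _ "blocks B"]) (simp_all del: wreath_Z_simps(1))
qed

section \<open>The eigenprojection of \<open>unit\<close> and its trace\<close>

definition eig_part :: "real \<Rightarrow> nat \<Rightarrow> (int \<Rightarrow> 'a) \<times> int \<Rightarrow> complex" where
  "eig_part \<mu> n = (\<lambda>x. \<Sum>m\<in>path_modes \<mu> n. mode_part n m x)"

lemma eig_part_eigsp: "eig_part \<mu> n \<in> eigsp (wreath_Z G) hop \<mu>"
  unfolding eig_part_def
  by (intro W.eigsp_sum) (use mode_part_eigsp in \<open>auto simp: path_modes_def\<close>)

lemma eig_part_norm_le: "l2_norm X (eig_part \<mu> n) \<le> 2 * real n * sqrt w ^ (n - 2)"
proof -
  let ?b = "2 * real n * sqrt w ^ (n - 2)"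
  have "l2_norm X (eig_part \<mu> n) \<le> (\<Sum>m\<in>path_modes \<mu> n. ?b)"
    unfolding eig_part_def
    by (rule order_trans[OF l2_norm_sum_le[OF mode_part_l2] sum_mono[OF mode_part_norm_le]])
  also have "\<dots> = real (card (path_modes \<mu> n)) * ?b" by simp
  also have "\<dots> \<le> 1 * ?b" using w_bounds card_path_modes_le[of \<mu> n] by (intro mult_right_mono) auto
  finally show ?thesis by simp
qed

text \<open>The series collects the mode parts with eigenvalue \<open>\<mu>\<close>, so it lies in
  the closed eigenspace. All other mode parts are orthogonal to that eigenspace, and
  \<open>blocks B\<close>, the sum of both kinds, tends to \<open>unit\<close>.\<close>

lemma orth_proj_unit:
  "orth_proj X (eigsp (wreath_Z G) hop \<mu>) unit = (\<lambda>x. \<Sum>n. eig_part \<mu> n x)"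
proof (rule W.orth_proj_eigsp_eqI[OF _ unit_l2])
  define k where "k = (\<lambda>x. \<Sum>n. eig_part \<mu> n x)"
  note l2 = W.eigspD(1)[OF eig_part_eigsp]
  note sm = l2 eig_part_norm_le summable_mode_bound
  have k: "k \<in> l2 X" unfolding k_def by (rule l2_suminf_in_l2[OF sm])
  show "(\<lambda>x. \<Sum>n. eig_part \<mu> n x) \<in> eigsp (wreath_Z G) hop \<mu>"
    by (rule W.eigsp_suminf[OF eig_part_eigsp eig_part_norm_le summable_mode_bound])
  fix \<eta> assume \<eta>: "\<eta> \<in> eigsp (wreath_Z G) hop \<mu>"
  have \<eta>2: "\<eta> \<in> l2 X" by (rule W.eigspD(1)[OF \<eta>])
  define P where "P = (\<lambda>B x. \<Sum>n<B. eig_part \<mu> n x)"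
  have P: "P B \<in> l2 X" for B unfolding P_def by (intro l2_sum l2)
  have bl: "blocks B \<in> l2 X" for B by (rule W.eigspan_l2[OF blocks_eigspan])
  have orth: "l2_inner X (\<lambda>x. blocks B x - P B x) \<eta> = 0" for B
  proof -
    have "blocks B x - P B x = (\<Sum>n<B. \<Sum>m\<in>{1..<n} - path_modes \<mu> n. mode_part n m x)" for x
      unfolding blocks_modes P_def eig_part_def sum_subtractf[symmetric]
      by (intro sum.cong refl sum_diff[symmetric]) (auto simp: path_modes_def)
    moreover have "l2_inner X (\<lambda>x. \<Sum>n<B. \<Sum>m\<in>{1..<n} - path_modes \<mu> n. mode_part n m x) \<eta>
        = (\<Sum>n<B. \<Sum>m\<in>{1..<n} - path_modes \<mu> n. l2_inner X (mode_part n m) \<eta>)"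
      by (simp add: l2_inner_sum_left l2_sum mode_part_l2 \<eta>2 del: wreath_Z_simps)
    moreover have "l2_inner X (mode_part n m) \<eta> = 0" if "m \<in> {1..<n} - path_modes \<mu> n" for n m
      by (rule W.eigsp_orthogonal[OF hop_grp_alg hop_sa _ mode_part_eigsp \<eta>])
        (use that in \<open>auto simp: path_modes_def\<close>)
    ultimately show ?thesis by (simp del: wreath_Z_simps)
  qed
  have bound: "cmod (l2_inner X (\<lambda>x. unit x - k x) \<eta>)
    \<le> (l2_norm X (\<lambda>x. unit x - blocks B x) + l2_norm X (\<lambda>x. k x - P B x)) * l2_norm X \<eta>" for B
  proof -
    let ?u = "\<lambda>x. unit x - blocks B x" and ?p = "\<lambda>x. k x - P B x" and ?q = "\<lambda>x. blocks B x - P B x"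
    have u: "?u \<in> l2 X" and p: "?p \<in> l2 X" and q: "?q \<in> l2 X"
      by (intro l2_diff unit_l2 bl P k)+
    \<comment> \<open>Inserting \<open>blocks B\<close> and \<open>P B\<close> leaves a summand
      orthogonal to \<open>\<eta>\<close> and two errors that tend to 0.\<close>
    have "(\<lambda>x. unit x - k x) = (\<lambda>x. (?u x - ?p x) + ?q x)" by auto
    then have "l2_inner X (\<lambda>x. unit x - k x) \<eta> = l2_inner X (\<lambda>x. ?u x - ?p x) \<eta>"
      using l2_inner_add_left[OF l2_diff[OF u p] q \<eta>2] orth[of B] by (simp del: wreath_Z_simps)
    also have "cmod \<dots> \<le> l2_norm X (\<lambda>x. ?u x - ?p x) * l2_norm X \<eta>"
      by (rule l2_Cauchy_Schwarz[OF l2_diff[OF u p] \<eta>2])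
    also have "\<dots> \<le> (l2_norm X ?u + l2_norm X ?p) * l2_norm X \<eta>"
      by (intro mult_right_mono l2_norm_triangle_diff u p) simp
    finally show ?thesis .
  qed
  have "(\<lambda>B. (l2_norm X (\<lambda>x. unit x - blocks B x) + l2_norm X (\<lambda>x. k x - P B x)) * l2_norm X \<eta>)
      \<longlonglongrightarrow> (0 + 0) * l2_norm X \<eta>"
    unfolding k_def P_def
    by (intro tendsto_intros blocks_tendsto l2_suminf_tendsto[OF sm])
  then have "cmod (l2_inner X (\<lambda>x. unit x - k x) \<eta>) \<le> (0 + 0) * l2_norm X \<eta>"
    by (rule LIMSEQ_le_const) (use bound in blast)
  then show "l2_inner X (\<lambda>x. unit x - (\<Sum>n. eig_part \<mu> n x)) \<eta> = 0" by (simp add: k_def)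
qed

lemma vN_dim_ker_sums:
  "(\<lambda>n. of_real (real (card (path_modes \<mu> n)) * block_trace n)) sums vN_dim_ker (wreath_Z G) hop \<mu>"
proof -
  have "vN_dim_ker (wreath_Z G) hop \<mu> = l2_inner X (orth_proj X (eigsp (wreath_Z G) hop \<mu>) unit) unit"
    by (simp add: vN_dim_ker_def del: wreath_Z_simps(1))
  also have "\<dots> = (\<Sum>n. eig_part \<mu> n (\<lambda>n. \<one>, 0))"
    unfolding orth_proj_unit by (subst l2_inner_delta) simp_all
  finally have dim: "vN_dim_ker (wreath_Z G) hop \<mu> = (\<Sum>n. eig_part \<mu> n (\<lambda>n. \<one>, 0))" .
  have one: "eig_part \<mu> n (\<lambda>n. \<one>, 0) = of_real (real (card (path_modes \<mu> n)) * block_trace n)" for n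
  proof -
    have "eig_part \<mu> n (\<lambda>n. \<one>, 0) = (\<Sum>m\<in>path_modes \<mu> n. of_real (block_trace n))"
      unfolding eig_part_def by (intro sum.cong refl mode_part_one) (auto simp: path_modes_def)
    then show ?thesis by simp
  qed
  show ?thesis unfolding dim one[symmetric]
    by (rule l2_suminf_sums[OF W.eigspD(1)[OF eig_part_eigsp] eig_part_norm_le summable_mode_bound])
qed

lemma vN_dim_ker_eq_0:
  assumes "\<mu> \<notin> (\<Union>n\<in>{2..}. M_set n)" shows "vN_dim_ker (wreath_Z G) hop \<mu> = 0"
  using vN_dim_ker_sums[of \<mu>] sums_unique2[OF sums_zero] by (fastforce simp: path_modes_empty[OF assms])

text \<open>Only the positive multiples of \<open>q\<close> contribute, each through one mode, so
  the dimension is a geometric series in \<open>w ^ q\<close>.\<close>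

lemma vN_dim_ker_eq:
  assumes "\<mu> \<in> M_set q" "q \<ge> 2"
  shows "vN_dim_ker (wreath_Z G) hop \<mu> = (1 / e \<one> - 1)\<^sup>2 / ((1 / e \<one>) ^ q - 1)"
proof -
  let ?f = "\<lambda>n. real (card (path_modes \<mu> n)) * block_trace n"
  have wq: "w ^ q < 1" using w_bounds assms(2) by (simp add: power_Suc_less_one power_less_one_iff)
  \<comment> \<open>Here \<open>q \<ge> 2\<close> makes the natural subtraction exact.\<close>
  have q2: "w ^ q = w ^ (q - 2) * w\<^sup>2" using assms(2) by (simp only: power_add[symmetric] le_add_diff_inverse2)
  have "(\<lambda>i. w ^ (q - 2) * (1 - w)\<^sup>2 * (w ^ q) ^ i) sums (w ^ (q - 2) * (1 - w)\<^sup>2 * (1 / (1 - w ^ q)))"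
    using wq w_bounds by (intro sums_mult geometric_sums) auto
  moreover have "?f (q * Suc i) = w ^ (q - 2) * (1 - w)\<^sup>2 * (w ^ q) ^ i" for i
  proof -
    have "q * Suc i - 2 = (q - 2) + q * i" using assms(2) by simp
    then have "w ^ (q * Suc i - 2) = w ^ (q - 2) * (w ^ q) ^ i" by (simp only: power_add power_mult)
    then show ?thesis using assms(2)
      by (simp add: card_path_modes[OF assms] block_trace_def del: mult_Suc_right)
  qed
  ultimately have "(\<lambda>i. ?f (q * Suc i)) sums (w ^ (q - 2) * (1 - w)\<^sup>2 / (1 - w ^ q))" by simp
  \<comment> \<open>Passes from the positive multiples \<open>q * Suc i\<close> to all
    \<open>n\<close>; the indices left out, including 0, carry no modes.\<close>
  then have "?f sums (w ^ (q - 2) * (1 - w)\<^sup>2 / (1 - w ^ q))"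
  proof (rule sums_mono_reindex[THEN iffD1, rotated 2])
    show "strict_mono (\<lambda>i. q * Suc i)" using assms(2) by (auto simp: strict_mono_def)
    fix n assume n: "n \<notin> range (\<lambda>i. q * Suc i)"
    have "\<not> (q dvd n \<and> n \<noteq> 0)"
    proof
      assume "q dvd n \<and> n \<noteq> 0"
      then obtain i where "n = q * Suc i" by (metis dvdE mult_0_right not0_implies_Suc)
      with n show False by blast
    qed
    then show "?f n = 0" by (auto simp: card_path_modes[OF assms])
  qed
  then have "(\<lambda>n. complex_of_real (?f n)) sums of_real (w ^ (q - 2) * (1 - w)\<^sup>2 / (1 - w ^ q))"
    by (rule sums_of_real)
  then have "vN_dim_ker (wreath_Z G) hop \<mu> = of_real (w ^ (q - 2) * (1 - w)\<^sup>2 / (1 - w ^ q))"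
    using vN_dim_ker_sums sums_unique2 by blast
  \<comment> \<open>Dividing numerator and denominator by \<open>w ^ q\<close> expresses the value
    through \<open>W = 1 / w\<close>.\<close>
  also have "w ^ (q - 2) * (1 - w)\<^sup>2 / (1 - w ^ q) = (1 / w - 1)\<^sup>2 / ((1 / w) ^ q - 1)"
  proof -
    have "(1 / w - 1)\<^sup>2 = (1 - w)\<^sup>2 / w\<^sup>2"
      using w_bounds by (simp add: diff_divide_distrib flip: power_divide)
    moreover have "(1 / w) ^ q - 1 = (1 - w ^ q) / w ^ q"
      using w_bounds by (simp add: power_one_over diff_divide_distrib)
    ultimately have "(1 / w - 1)\<^sup>2 / ((1 / w) ^ q - 1) = w ^ q / w\<^sup>2 * (1 - w)\<^sup>2 / (1 - w ^ q)"
      by simp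
    also have "w ^ q / w\<^sup>2 = w ^ (q - 2)" using w_bounds by (simp add: q2)
    finally show ?thesis by simp
  qed
  finally show ?thesis by (simp add: e_one)
qed

end

theorem theorem1p1:
  fixes U :: "('a,'b) monoid_scheme" and e :: "'a \<Rightarrow> complex"
  assumes grp: "group U"
    and torsion: "\<exists>x\<in>carrier U. x \<noteq> \<one>\<^bsub>U\<^esub> \<and> (\<exists>n::nat. n > 0 \<and> x [^]\<^bsub>U\<^esub> n = \<one>\<^bsub>U\<^esub>)"
    and e_elem: "e \<in> grp_alg U"
    and e_sa: "star U e = e"
    and e_idem: "conv U e e = e"
    and e_nz: "e \<noteq> (\<lambda>x. 0)"
    and e_n1: "e \<noteq> delta \<one>\<^bsub>U\<^esub>"
    and W_def: "W = 1 / e \<one>\<^bsub>U\<^esub>"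
    and T_def: "T = (\<lambda>x. conv (wreath_Z U) (wr_lift U e) (delta (wr_t U)) x
                      + conv (wreath_Z U) (delta (wr_tinv U)) (wr_lift U e) x)"
  shows "(\<forall>\<mu>::real. (\<forall>n\<ge>2. \<mu> \<in> M_set n \<longrightarrow>
              vN_dim_ker (wreath_Z U) T \<mu> = (W - 1)\<^sup>2 / (W ^ n - 1))
          \<and> (\<mu> \<notin> (\<Union>n\<in>{2..}. M_set n) \<longrightarrow> vN_dim_ker (wreath_Z U) T \<mu> = 0))
       \<and> (\<forall>\<xi>\<in>l2 (carrier (wreath_Z U)). \<forall>\<epsilon>>0. \<exists>F \<eta>. finite F
              \<and> (\<forall>\<mu>\<in>F. \<eta> \<mu> \<in> eigsp (wreath_Z U) T \<mu>)
              \<and> l2_norm (carrier (wreath_Z U)) (\<lambda>x. \<xi> x - (\<Sum>\<mu>\<in>F. \<eta> \<mu> x)) < \<epsilon>)"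
proof -
  interpret U: group_projection U e
    using grp e_elem e_sa e_idem e_nz e_n1
    by (simp add: group_projection_def group_projection_axioms_def)
  have T: "T = U.hop" by (simp add: T_def U.hop_def)
  show ?thesis unfolding T W_def
  proof (intro conjI allI impI ballI)
    fix \<xi> :: "(int \<Rightarrow> 'a) \<times> int \<Rightarrow> complex" and \<epsilon> :: real
    assume \<xi>: "\<xi> \<in> l2 (carrier (wreath_Z U))" and \<epsilon>: "\<epsilon> > 0"
    from U.eigspan_hop_dense[OF \<xi> \<epsilon>]
    show "\<exists>F \<eta>. finite F \<and> (\<forall>\<mu>\<in>F. \<eta> \<mu> \<in> eigsp (wreath_Z U) U.hop \<mu>)
        \<and> l2_norm (carrier (wreath_Z U)) (\<lambda>x. \<xi> x - (\<Sum>\<mu>\<in>F. \<eta> \<mu> x)) < \<epsilon>"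
      unfolding group.eigspan_def[OF U.group_wreath_Z] by blast
  qed (use U.vN_dim_ker_eq U.vN_dim_ker_eq_0 in auto)
qed

end
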